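(* Let $d\ge1$ and $W=[0,1]^d$. Let $X$ be a random field and $(X_n)_{n\ge1}$ a sequence of random fields on $W$, all with sample paths in $C^2(W)$. Assume that $X$ is almost surely an MB function. For $\ell=0,\dots,d$ let $$\mathbf Y_\ell=\{t\in W: X'(t)=0,\ \iota\{X''(t)\}=\ell\},\qquad \mathbf Y_{n,\ell}=\{t\in W: X_n'(t)=0,\ \iota\{X_n''(t)\}=\ell\}.$$ (a) If $X_n\to X$ almost surely in $C^2(W)$ as $n\to\infty$, then for all $\ell=0,\dots,d$, $\mathbf Y_{n,\ell}\to\mathbf Y_\ell$ almost surely. (b) If $X_n\to X$ in distribution in $C^2(W)$ as $n\to\infty$, then for all $\ell=0,\dots,d$, $\mathbf Y_{n,\ell}\to\mathbf Y_\ell$ in distribution.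
   Context: $f'$ and $f''$ denote gradient and Hessian of a function $f\in C^2(W)$, and $\iota(M)$ is the number of negative eigenvalues of a symmetric matrix $M$. A function $f\in C^2(W)$ is a Morse function if $f'(t)=0$ implies $\det f''(t)\neq0$ for all $t\in W$; it is an MB function if it is Morse and has no critical point on the boundary of $W$. $C^2(W)$ carries the norm $\|f\|_{C^2(W)}=\sum_{|\alpha|\le2}\sup_{x\in W}|\partial^\alpha f(x)|$. Almost sure convergence in $C^2(W)$ means $\|X_n-X\|_{C^2(W)}\to0$ a.s.; convergence in distribution in $C^2(W)$ means $\mathbb E\,h(X_n)\to\mathbb E\,h(X)$ for every bounded continuous $h:C^2(W)\to\mathbb R$. Convergence of sets: for a finite set $S=\{x_1,\dots,x_p\}$ and sets $S^n=\{x^n_1,\dots,x^n_{p_n}\}$ (with $p$, resp. $p_n$, distinct elements), $S^n\to S$ means $\lim_n p_n=p$ (so $S^n$ has exactly $p$ points for $n$ large) and there exist maps $\phi_n:\{1,\dots,p\}\to\{1,\dots,p_n\}$ such that $x^n_{\phi_n(k)}\to x_k$ for every $k=1,\dots,p$. Convergence in distribution of random sets is weak convergence with respect to the topology on finite subsets of $W$ corresponding to this convergence (an infinite $\mathbf Y_{n,\ell}$ being treated as one additional isolated element). *)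

theory Defs
  imports "HOL-Probability.Probability"
begin

section \<open>The space of twice continuously differentiable functions on the unit cube\<close>

abbreviation unit_cube :: "(real ^ 'd) set" where
  "unit_cube \<equiv> cbox 0 1"

text \<open>Derivatives are taken within the closed cube, hence are one-sided at its boundary; they are
  unique at every point of the cube. The values of a function outside the cube play no role.\<close>

definition partial_deriv :: "'d \<Rightarrow> (real ^ 'd \<Rightarrow> real) \<Rightarrow> real ^ 'd \<Rightarrow> real" where
  "partial_deriv i f t = frechet_derivative f (at t within unit_cube) (axis i 1)"

definition C2_functions :: "(real ^ 'd \<Rightarrow> real) set" where
  "C2_functions = {f. f differentiable_on unit_cube \<and>
     (\<forall>i. partial_deriv i f differentiable_on unit_cube) \<and>
     (\<forall>i j. continuous_on unit_cube (partial_deriv i (partial_deriv j f)))}"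

definition gradient :: "(real ^ 'd \<Rightarrow> real) \<Rightarrow> real ^ 'd \<Rightarrow> real ^ 'd" where
  "gradient f t = (\<chi> i. partial_deriv i f t)"

definition hessian :: "(real ^ 'd \<Rightarrow> real) \<Rightarrow> real ^ 'd \<Rightarrow> real ^ 'd ^ 'd" where
  "hessian f t = (\<chi> i j. partial_deriv i (partial_deriv j f) t)"

text \<open>For a multi-index \<open>\<alpha>\<close>, differentiate \<open>\<alpha> i\<close> times in each direction \<open>i\<close>. The order is chosen
  arbitrarily, which is immaterial for the derivatives of order at most two of a \<open>C\<^sup>2\<close> function.\<close>

definition multi_deriv :: "('d \<Rightarrow> nat) \<Rightarrow> (real ^ 'd \<Rightarrow> real) \<Rightarrow> real ^ 'd \<Rightarrow> real" where
  "multi_deriv \<alpha> f = foldr partial_deriv (SOME is. \<forall>i. count_list is i = \<alpha> i) f"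

definition C2_norm :: "(real ^ 'd \<Rightarrow> real) \<Rightarrow> real" where
  "C2_norm f = (\<Sum>\<alpha> | (\<Sum>i\<in>UNIV. \<alpha> i) \<le> (2::nat). SUP t\<in>unit_cube. \<bar>multi_deriv \<alpha> f t\<bar>)"

text \<open>Functions that agree on the cube are topologically indistinguishable here, so that continuous
  real functionals only depend on the restriction to the cube.\<close>

definition C2_topology :: "(real ^ 'd \<Rightarrow> real) topology" where
  "C2_topology = topology (\<lambda>U. U \<subseteq> C2_functions \<and>
     (\<forall>f\<in>U. \<exists>\<epsilon>>0. \<forall>g\<in>C2_functions. C2_norm (\<lambda>t. g t - f t) < \<epsilon> \<longrightarrow> g \<in> U))"

lemma openin_C2_topology:
  "openin C2_topology U \<longleftrightarrow> U \<subseteq> C2_functions \<and>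
     (\<forall>f\<in>U. \<exists>\<epsilon>>0. \<forall>g\<in>C2_functions. C2_norm (\<lambda>t. g t - f t) < \<epsilon> \<longrightarrow> g \<in> U)"
proof -
  let ?Q = "\<lambda>f U \<epsilon>. \<forall>g\<in>C2_functions. C2_norm (\<lambda>t. g t - f t) < \<epsilon> \<longrightarrow> g \<in> U"
  have "istopology (\<lambda>U. U \<subseteq> C2_functions \<and> (\<forall>f\<in>U. \<exists>\<epsilon>>0. ?Q f U \<epsilon>))"
    unfolding istopology_def
  proof (intro conjI allI impI ballI)
    fix S T f
    assume S: "S \<subseteq> C2_functions \<and> (\<forall>f\<in>S. \<exists>\<epsilon>>0. ?Q f S \<epsilon>)"
      and T: "T \<subseteq> C2_functions \<and> (\<forall>f\<in>T. \<exists>\<epsilon>>0. ?Q f T \<epsilon>)" and f: "f \<in> S \<inter> T"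
    obtain a b where "a > 0" "?Q f S a" "b > 0" "?Q f T b"
      using S T f by blast
    then show "\<exists>\<epsilon>>0. ?Q f (S \<inter> T) \<epsilon>"
      by (intro exI[of _ "min a b"]) auto
  next
    fix K f assume "\<forall>U\<in>K. U \<subseteq> C2_functions \<and> (\<forall>f\<in>U. \<exists>\<epsilon>>0. ?Q f U \<epsilon>)" "f \<in> \<Union>K"
    then show "\<exists>\<epsilon>>0. ?Q f (\<Union>K) \<epsilon>" by (meson UnionE UnionI)
  qed blast+
  then show ?thesis unfolding C2_topology_def by (subst topology_inverse') auto
qed

lemma topspace_C2_topology [simp]: "topspace C2_topology = C2_functions"
proof -
  have "openin C2_topology C2_functions"
    unfolding openin_C2_topology by (auto intro: exI[of _ "1::real"])
  then show ?thesis
    unfolding topspace_def using openin_C2_topology by blast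
qed

section \<open>Morse functions and critical points\<close>

definition eigenspace :: "real ^ 'd ^ 'd \<Rightarrow> real \<Rightarrow> (real ^ 'd) set" where
  "eigenspace A \<mu> = {v. A *v v = \<mu> *\<^sub>R v}"

definition eigenvalues :: "real ^ 'd ^ 'd \<Rightarrow> real set" where
  "eigenvalues A = {\<mu>. \<exists>v\<in>eigenspace A \<mu>. v \<noteq> 0}"

text \<open>Eigenvalues are counted with multiplicity (for symmetric matrices, geometric and algebraic
  multiplicities agree).\<close>

definition matrix_index :: "real ^ 'd ^ 'd \<Rightarrow> nat" where
  "matrix_index A = (\<Sum>\<mu> | \<mu> \<in> eigenvalues A \<and> \<mu> < 0. dim (eigenspace A \<mu>))"

definition Morse_function :: "(real ^ 'd \<Rightarrow> real) \<Rightarrow> bool" where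
  "Morse_function f \<longleftrightarrow> f \<in> C2_functions \<and>
     (\<forall>t\<in>unit_cube. gradient f t = 0 \<longrightarrow> det (hessian f t) \<noteq> 0)"

definition MB_function :: "(real ^ 'd \<Rightarrow> real) \<Rightarrow> bool" where
  "MB_function f \<longleftrightarrow> Morse_function f \<and> (\<forall>t\<in>frontier unit_cube. gradient f t \<noteq> 0)"

definition critical_points :: "nat \<Rightarrow> (real ^ 'd \<Rightarrow> real) \<Rightarrow> (real ^ 'd) set" where
  "critical_points l f = {t \<in> unit_cube. gradient f t = 0 \<and> matrix_index (hessian f t) = l}"

section \<open>Convergence of finite sets\<close>

text \<open>The map \<open>\<phi> n\<close> selects points of \<open>F n\<close> directly rather than their labels.\<close>

definition set_converges :: "(nat \<Rightarrow> (real ^ 'd) set) \<Rightarrow> (real ^ 'd) set \<Rightarrow> bool" where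
  "set_converges F S \<longleftrightarrow> finite S \<and>
     (\<forall>\<^sub>F n in sequentially. finite (F n) \<and> card (F n) = card S) \<and>
     (\<exists>\<phi>. (\<forall>\<^sub>F n in sequentially. \<phi> n \<in> S \<rightarrow> F n) \<and> (\<forall>x\<in>S. (\<lambda>n. \<phi> n x) \<longlonglongrightarrow> x))"

text \<open>\<open>Some S\<close> stands for a finite subset of the cube, \<open>None\<close> for the additional isolated element that
  represents all infinite subsets. On the finite subsets, this is the topology of the sequentially
  open sets of the above convergence.\<close>

definition set_element :: "(real ^ 'd) set \<Rightarrow> (real ^ 'd) set option" where
  "set_element S = (if finite S then Some S else None)"

definition finite_set_topology :: "(real ^ 'd) set option topology" where
  "finite_set_topology = topology (\<lambda>U. U \<subseteq> insert None (Some ` {S. finite S \<and> S \<subseteq> unit_cube}) \<and>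
     (\<forall>F S. Some S \<in> U \<and> (\<forall>n. finite (F n) \<and> F n \<subseteq> unit_cube) \<and> set_converges F S \<longrightarrow>
       (\<forall>\<^sub>F n in sequentially. Some (F n) \<in> U)))"

lemma openin_finite_set_topology:
  "openin finite_set_topology U \<longleftrightarrow> U \<subseteq> insert None (Some ` {S. finite S \<and> S \<subseteq> unit_cube}) \<and>
     (\<forall>F S. Some S \<in> U \<and> (\<forall>n. finite (F n) \<and> F n \<subseteq> unit_cube) \<and> set_converges F S \<longrightarrow>
       (\<forall>\<^sub>F n in sequentially. Some (F n) \<in> U))"
proof -
  let ?C = "insert None (Some ` {S. finite S \<and> S \<subseteq> unit_cube})"
  let ?A = "\<lambda>F S. (\<forall>n. finite (F n) \<and> F n \<subseteq> unit_cube) \<and> set_converges F S"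
  have "istopology (\<lambda>U. U \<subseteq> ?C \<and>
    (\<forall>F S. Some S \<in> U \<and> ?A F S \<longrightarrow> (\<forall>\<^sub>F n in sequentially. Some (F n) \<in> U)))"
    unfolding istopology_def
  proof (intro conjI allI impI)
    fix K F S
    assume K: "\<forall>U\<in>K. U \<subseteq> ?C \<and>
        (\<forall>F S. Some S \<in> U \<and> ?A F S \<longrightarrow> (\<forall>\<^sub>F n in sequentially. Some (F n) \<in> U))"
      and S: "Some S \<in> \<Union>K \<and> ?A F S"
    then obtain U where "U \<in> K" "\<forall>\<^sub>F n in sequentially. Some (F n) \<in> U" by blast
    then show "\<forall>\<^sub>F n in sequentially. Some (F n) \<in> \<Union>K"
      by (auto elim: eventually_mono)
  next
    fix U V F S
    assume "U \<subseteq> ?C \<and> (\<forall>F S. Some S \<in> U \<and> ?A F S \<longrightarrow> (\<forall>\<^sub>F n in sequentially. Some (F n) \<in> U))"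
      and "V \<subseteq> ?C \<and> (\<forall>F S. Some S \<in> V \<and> ?A F S \<longrightarrow> (\<forall>\<^sub>F n in sequentially. Some (F n) \<in> V))"
      and "Some S \<in> U \<inter> V \<and> ?A F S"
    then have "\<forall>\<^sub>F n in sequentially. Some (F n) \<in> U" "\<forall>\<^sub>F n in sequentially. Some (F n) \<in> V"
      by blast+
    then show "\<forall>\<^sub>F n in sequentially. Some (F n) \<in> U \<inter> V"
      by eventually_elim auto
  qed blast+
  then show ?thesis unfolding finite_set_topology_def by (subst topology_inverse') auto
qed

lemma topspace_finite_set_topology [simp]:
  "topspace finite_set_topology = insert None (Some ` {S. finite S \<and> S \<subseteq> unit_cube})"
proof -
  have "openin finite_set_topology (insert None (Some ` {S. finite S \<and> S \<subseteq> unit_cube}))"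
    unfolding openin_finite_set_topology by auto
  then show ?thesis
    unfolding topspace_def using openin_finite_set_topology by blast
qed

lemma openin_finite_set_topology_None: "openin finite_set_topology {None}"
  unfolding openin_finite_set_topology by auto

section \<open>Random fields and convergence in distribution\<close>

definition C2_random_field :: "'a measure \<Rightarrow> ('a \<Rightarrow> real ^ 'd \<Rightarrow> real) \<Rightarrow> bool" where
  "C2_random_field M X \<longleftrightarrow> (\<forall>t\<in>unit_cube. (\<lambda>\<omega>. X \<omega> t) \<in> borel_measurable M) \<and>
     (\<forall>\<omega>\<in>space M. X \<omega> \<in> C2_functions)"

definition converges_in_distribution ::
  "'b topology \<Rightarrow> (nat \<Rightarrow> 'a measure) \<Rightarrow> (nat \<Rightarrow> 'a \<Rightarrow> 'b) \<Rightarrow> 'a measure \<Rightarrow> ('a \<Rightarrow> 'b) \<Rightarrow> bool" where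
  "converges_in_distribution T Ms Zs M Z \<longleftrightarrow>
     (\<forall>h. continuous_map T euclideanreal h \<and> bounded (h ` topspace T) \<longrightarrow>
       (\<lambda>n. \<integral>\<omega>. h (Zs n \<omega>) \<partial>Ms n) \<longlonglongrightarrow> (\<integral>\<omega>. h (Z \<omega>) \<partial>M))"

end

theory Submission imports Defs begin

text \<open>Near a nondegenerate interior critical point \<open>x\<close> of \<open>f\<close> with Hessian \<open>A\<close>, the map
  \<open>t \<mapsto> t - A\<^sup>-\<^sup>1 g'(t)\<close> is a contraction of a small ball for every \<open>g\<close> that is \<open>C\<^sup>2\<close>-close to \<open>f\<close>, so \<open>g\<close> has
  exactly one critical point there, and its index is that of \<open>A\<close> because the index is locally constant at
  nonsingular symmetric matrices. Away from these balls \<open>f'\<close> is bounded below, so \<open>g\<close> has no other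
  critical points. This gives (a).

  For (b), let \<open>h\<close> be a bounded continuous function of finite sets and \<open>H f\<close> its value at the critical
  points of \<open>f\<close>; by (a), \<open>H\<close> is continuous at MB functions. These are the functions with positive gap \<open>\<psi>\<close>,
  where \<open>\<psi>\<close> is a continuous functional, so \<open>H \<cdot> min 1 (m \<psi>)\<close> is continuous everywhere and serves as a
  test function. Since \<open>min 1 (m \<psi> X) \<rightarrow> 1\<close> almost surely as \<open>m \<rightarrow> \<infinity>\<close>, the cutoff is removed in the limit.
  Measurability of \<open>H X\<^sub>n\<close>, also where \<open>X\<^sub>n\<close> is not MB, holds because the symmetric matrices of a given
  index form a countable union of closed sets: the event that some point of a compact set is critical
  with that index is then reduced to a countable dense set of points.\<close>

section \<open>Index of symmetric matrices\<close>

text \<open>The fields \<open>Xs n\<close> may live on different probability spaces, only point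
  evaluations are assumed measurable, and convergence in distribution is tested against bounded
  functionals continuous on \<open>C2_topology\<close>. Since \<open>H\<close> may jump at functions
  that are not MB, it is no test function itself; the cutoff stands in for a continuous mapping
  theorem. Removing it for \<open>Xs n\<close>, which is not assumed MB, requires the expected
  cutoff to be close to 1 for all large \<open>n\<close>; this follows by using the cutoff alone as
  a second test function. Measurability is a genuine obligation: the integral of a nonmeasurable
  function is 0 by convention, which would spoil the comparison of \<open>H\<close> with its cut-off
  version. The closed cube shapes the rest: derivatives at the boundary are one-sided, so difference
  quotients run along segments pointing into the cube, and nearby critical points are constructed
  only around interior points, where a closed ball fits into the cube.\<close>

lemma inner_symmetric_matrix:
  fixes A :: "real ^ 'n ^ 'n"
  assumes "transpose A = A"
  shows "x \<bullet> (A *v y) = (A *v x) \<bullet> y"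
  by (metis assms dot_lmul_matrix vector_transpose_matrix)

text \<open>Maximising the Rayleigh quotient over the unit sphere of the subspace yields an eigenvector.\<close>

lemma symmetric_matrix_eigenvector_in_subspace:
  fixes A :: "real ^ 'n ^ 'n"
  assumes sym: "transpose A = A" and V: "subspace V" "\<And>v. v \<in> V \<Longrightarrow> A *v v \<in> V" and "V \<noteq> {0}"
  obtains u \<mu> where "u \<in> V" "norm u = 1" "A *v u = \<mu> *\<^sub>R u"
proof -
  let ?S = "sphere 0 1 \<inter> V" and ?q = "\<lambda>v. v \<bullet> (A *v v)"
  obtain w where w: "w \<in> V" "w \<noteq> 0" using \<open>V \<noteq> {0}\<close> subspace_0[OF V(1)] by blast
  have "compact ?S" by (simp add: closed_subspace V(1) compact_Int_closed)
  moreover have "(1 / norm w) *\<^sub>R w \<in> ?S" using w V(1) by (auto simp: subspace_scale)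
  then have "?S \<noteq> {}" by blast
  moreover have "continuous_on ?S ?q"
    by (intro continuous_intros matrix_vector_mult_linear_continuous_on)
  ultimately obtain u where u: "u \<in> ?S" and max: "\<And>v. v \<in> ?S \<Longrightarrow> ?q v \<le> ?q u"
    using continuous_attains_sup[of ?S ?q] by blast
  define l where "l = ?q u"
  have uV: "u \<in> V" and nu: "norm u = 1" using u by auto
  have uu: "u \<bullet> u = 1" using nu by (simp add: dot_square_norm)
  have ray: "?q v \<le> l * (v \<bullet> v)" if "v \<in> V" for v
  proof (cases "v = 0")
    case False
    have "(1 / norm v) *\<^sub>R v \<in> ?S" using that False V(1) by (auto simp: subspace_scale)
    from max[OF this] have "?q v / (norm v)\<^sup>2 \<le> l"
      by (simp add: l_def matrix_vector_mult_scaleR power2_eq_square)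
    then show ?thesis using False by (simp add: divide_le_eq dot_square_norm)
  qed simp
  have orth: "w \<bullet> (A *v u) = 0" if w: "w \<in> V" "w \<bullet> u = 0" for w
  proof (rule ccontr)
    assume c: "w \<bullet> (A *v u) \<noteq> 0"
    define c where "c = w \<bullet> (A *v u)"
    define K where "K = l * (w \<bullet> w) - ?q w"
    have *: "2 * s * c \<le> s\<^sup>2 * K" for s
    proof -
      have "u + s *\<^sub>R w \<in> V" using uV w V(1) by (simp add: subspace_add subspace_scale)
      from ray[OF this] have "?q (u + s *\<^sub>R w) \<le> l * ((u + s *\<^sub>R w) \<bullet> (u + s *\<^sub>R w))" .
      moreover have "?q (u + s *\<^sub>R w) = l + 2 * s * c + s\<^sup>2 * ?q w"
        using inner_symmetric_matrix[OF sym, of u w]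
        by (simp add: matrix_vector_right_distrib matrix_vector_mult_scaleR inner_add_left
            inner_add_right l_def c_def power2_eq_square algebra_simps inner_commute)
      moreover have "(u + s *\<^sub>R w) \<bullet> (u + s *\<^sub>R w) = 1 + s\<^sup>2 * (w \<bullet> w)"
        using w(2) uu by (simp add: inner_add_left inner_add_right power2_eq_square inner_commute)
      ultimately have "l + 2 * s * c + s\<^sup>2 * ?q w \<le> l * (1 + s\<^sup>2 * (w \<bullet> w))" by simp
      then show ?thesis by (simp add: K_def algebra_simps)
    qed
    have "c \<noteq> 0" using c c_def by simp
    \<comment> \<open>A step \<open>s\<close> with the sign of \<open>c\<close>, so small that the
      linear term \<open>2 * s * c\<close> beats the quadratic one; the \<open>+ 1\<close> keeps the
      denominator positive when \<open>K = 0\<close>.\<close>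
    have "2 * (c / (\<bar>K\<bar> + 1)) * c \<le> (c / (\<bar>K\<bar> + 1))\<^sup>2 * K" by (rule *)
    also have "\<dots> \<le> (c / (\<bar>K\<bar> + 1))\<^sup>2 * (\<bar>K\<bar> + 1)" by (intro mult_left_mono) auto
    also have "\<dots> = c\<^sup>2 / (\<bar>K\<bar> + 1)"
      by (simp add: power2_eq_square add_nonneg_eq_0_iff)
    finally have "2 * (c\<^sup>2 / (\<bar>K\<bar> + 1)) \<le> c\<^sup>2 / (\<bar>K\<bar> + 1)" by (simp add: power2_eq_square)
    moreover have "c\<^sup>2 / (\<bar>K\<bar> + 1) > 0" using \<open>c \<noteq> 0\<close> by (simp add: add_nonneg_pos)
    ultimately show False by linarith
  qed
  \<comment> \<open>The residual of the eigenvalue equation lies in \<open>V\<close> by invariance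
    and is orthogonal to \<open>u\<close>, so it is admissible in \<open>orth\<close>; this makes it
    orthogonal to itself.\<close>
  define z where "z = A *v u - l *\<^sub>R u"
  have zV: "z \<in> V" unfolding z_def using V uV by (simp add: subspace_diff subspace_scale)
  have zu: "z \<bullet> u = 0"
    unfolding z_def inner_commute[of _ u] using uu by (simp add: inner_diff_right l_def)
  have "z \<bullet> z = z \<bullet> (A *v u) - l * (z \<bullet> u)" by (simp add: z_def inner_diff_right)
  also have "\<dots> = 0" using orth[OF zV zu] zu by simp
  finally have "A *v u = l *\<^sub>R u" by (simp add: z_def)
  with uV nu show thesis using that by blast
qed

text \<open>Eigenvalues are written as Rayleigh quotients of the unit vectors, so \<open>B\<close>
  alone carries the spectrum with multiplicities.\<close>

definition orthonormal_eigenbasis :: "real ^ 'n ^ 'n \<Rightarrow> (real ^ 'n) set \<Rightarrow> bool" where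
  "orthonormal_eigenbasis A B \<longleftrightarrow> pairwise orthogonal B \<and> span B = UNIV \<and>
     (\<forall>b\<in>B. norm b = 1 \<and> A *v b = (b \<bullet> (A *v b)) *\<^sub>R b)"

text \<open>Spectral theorem, by induction on the dimension of an invariant subspace: the orthogonal
  complement of an eigenvector inside it is again invariant because \<open>A\<close> is
  symmetric.\<close>

theorem symmetric_matrix_eigenbasis:
  fixes A :: "real ^ 'n ^ 'n"
  assumes sym: "transpose A = A"
  obtains B where "orthonormal_eigenbasis A B"
proof -
  have "\<exists>B. pairwise orthogonal B \<and> span B = V \<and>
      (\<forall>b\<in>B. norm b = 1 \<and> A *v b = (b \<bullet> (A *v b)) *\<^sub>R b)"
    if "subspace V" "\<And>v. v \<in> V \<Longrightarrow> A *v v \<in> V" for V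
    using that
  proof (induction "dim V" arbitrary: V rule: less_induct)
    case less
    show ?case
    proof (cases "V = {0}")
      case True
      then show ?thesis by (intro exI[of _ "{}"]) auto
    next
      case False
      obtain u \<mu> where u: "u \<in> V" "norm u = 1" "A *v u = \<mu> *\<^sub>R u"
        using symmetric_matrix_eigenvector_in_subspace[OF sym less.prems False] by blast
      have uu: "u \<bullet> u = 1" using u(2) by (simp add: dot_square_norm)
      define V' where "V' = {v \<in> V. u \<bullet> v = 0}"
      have sub: "subspace V'"
        unfolding V'_def subspace_def using less.prems(1)
        by (auto simp: inner_add_right subspace_0 subspace_add subspace_scale)
      have inv: "A *v v \<in> V'" if "v \<in> V'" for v
        using that less.prems(2) inner_symmetric_matrix[OF sym, of u v] u(3) by (auto simp: V'_def)
      have "u \<notin> V'" using uu by (simp add: V'_def)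
      then have "V' \<subset> V" using u(1) unfolding V'_def by blast
      then have "dim V' < dim V"
        using sub less.prems(1) by (simp add: dim_psubset span_eq_iff[THEN iffD2])
      from less.hyps[OF this sub inv] obtain B where B: "pairwise orthogonal B" "span B = V'"
        "\<forall>b\<in>B. norm b = 1 \<and> A *v b = (b \<bullet> (A *v b)) *\<^sub>R b" by blast
      have "B \<subseteq> V'" using B(2) span_superset by blast
      then have "pairwise orthogonal (insert u B)"
        using B(1) by (intro pairwise_orthogonal_insert) (auto simp: V'_def orthogonal_def)
      moreover have "span (insert u B) = V"
      proof
        show "span (insert u B) \<subseteq> V"
          using u(1) \<open>B \<subseteq> V'\<close> less.prems(1) by (intro span_minimal) (auto simp: V'_def)
        show "V \<subseteq> span (insert u B)"
        proof
          fix v assume v: "v \<in> V"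
          have "v - (u \<bullet> v) *\<^sub>R u \<in> V'"
            using v u(1) uu less.prems(1)
            by (simp add: V'_def subspace_diff subspace_scale inner_diff_right)
          then show "v \<in> span (insert u B)" by (auto simp: span_insert B(2))
        qed
      qed
      moreover have "A *v u = (u \<bullet> (A *v u)) *\<^sub>R u" using u(3) uu by simp
      ultimately show ?thesis using B(3) u(2) by (intro exI[of _ "insert u B"]) auto
    qed
  qed
  from this[of UNIV] show thesis using that by (auto simp: orthonormal_eigenbasis_def)
qed

section \<open>Quadratic form, eigenspaces and index in terms of an eigenbasis\<close>

context
  fixes A :: "real ^ 'n ^ 'n" and B :: "(real ^ 'n) set"
  assumes B: "orthonormal_eigenbasis A B"
begin

lemma eigenbasis_finite: "finite B"
  using B pairwise_orthogonal_imp_finite by (auto simp: orthonormal_eigenbasis_def)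

lemma eigenbasis_inner: "b \<in> B \<Longrightarrow> c \<in> B \<Longrightarrow> b \<bullet> c = (if b = c then 1 else 0)"
  using B by (auto simp: orthonormal_eigenbasis_def pairwise_def orthogonal_def dot_square_norm)

lemma eigenbasis_expand: "v = (\<Sum>b\<in>B. (v \<bullet> b) *\<^sub>R b)"
  using orthonormal_basis_expand[of B v] B eigenbasis_finite
  by (simp add: orthonormal_eigenbasis_def)

lemma eigenbasis_independent_subset:
  assumes "C \<subseteq> B"
  shows "independent C"
proof (rule pairwise_orthogonal_independent)
  show "pairwise orthogonal C"
    using B assms by (auto simp: orthonormal_eigenbasis_def intro: pairwise_subset)
  show "0 \<notin> C"
    using B assms unfolding orthonormal_eigenbasis_def by (metis norm_zero subsetD zero_neq_one)
qed

lemma eigenbasis_card: "card B = CARD('n)"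
  using eigenbasis_independent_subset[of B] B dim_eq_card[of B UNIV]
  by (simp add: orthonormal_eigenbasis_def)

lemma eigenbasis_inner_span:
  assumes "C \<subseteq> B" "v \<in> span C" "b \<in> B - C"
  shows "v \<bullet> b = 0"
proof -
  have "orthogonal b v"
    using assms eigenbasis_inner by (intro orthogonal_to_span[of v C]) (auto simp: orthogonal_def)
  then show ?thesis by (simp add: orthogonal_def inner_commute)
qed

lemma eigenbasis_quadratic_form: "v \<bullet> (A *v v) = (\<Sum>b\<in>B. (b \<bullet> (A *v b)) * (v \<bullet> b)\<^sup>2)"
proof -
  have "A *v v = A *v (\<Sum>b\<in>B. (v \<bullet> b) *\<^sub>R b)" using eigenbasis_expand[of v] by simp
  also have "\<dots> = (\<Sum>b\<in>B. (v \<bullet> b) *\<^sub>R (A *v b))"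
    by (simp add: linear_sum[OF matrix_vector_mul_linear] matrix_vector_mult_scaleR)
  also have "\<dots> = (\<Sum>b\<in>B. ((b \<bullet> (A *v b)) * (v \<bullet> b)) *\<^sub>R b)"
  proof (rule sum.cong[OF refl])
    fix b assume "b \<in> B"
    then have "A *v b = (b \<bullet> (A *v b)) *\<^sub>R b" using B by (simp add: orthonormal_eigenbasis_def)
    then show "(v \<bullet> b) *\<^sub>R (A *v b) = ((b \<bullet> (A *v b)) * (v \<bullet> b)) *\<^sub>R b"
      by (metis mult.commute scaleR_scaleR)
  qed
  finally show ?thesis
    by (simp add: inner_sum_right power2_eq_square mult.assoc)
qed

lemma eigenbasis_norm: "v \<bullet> v = (\<Sum>b\<in>B. (v \<bullet> b)\<^sup>2)"
proof -
  have "v \<bullet> v = v \<bullet> (\<Sum>b\<in>B. (v \<bullet> b) *\<^sub>R b)" using eigenbasis_expand[of v] by simp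
  then show ?thesis by (simp add: inner_sum_right power2_eq_square)
qed

lemma eigenspace_eq_span_eigenbasis: "eigenspace A \<mu> = span {b\<in>B. b \<bullet> (A *v b) = \<mu>}"
proof
  have "subspace (eigenspace A \<mu>)"
    by (auto simp: subspace_def eigenspace_def matrix_vector_right_distrib
        matrix_vector_mult_scaleR scaleR_add_right)
  then show "span {b\<in>B. b \<bullet> (A *v b) = \<mu>} \<subseteq> eigenspace A \<mu>"
    using B by (intro span_minimal) (auto simp: eigenspace_def orthonormal_eigenbasis_def)
  show "eigenspace A \<mu> \<subseteq> span {b\<in>B. b \<bullet> (A *v b) = \<mu>}"
  proof
    fix v assume v: "v \<in> eigenspace A \<mu>"
    have zero: "v \<bullet> b = 0" if "b \<in> B" "b \<bullet> (A *v b) \<noteq> \<mu>" for b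
    proof -
      have "A *v v = A *v (\<Sum>c\<in>B. (v \<bullet> c) *\<^sub>R c)" using eigenbasis_expand[of v] by simp
      also have "\<dots> = (\<Sum>c\<in>B. (v \<bullet> c) *\<^sub>R (A *v c))"
        by (simp add: linear_sum[OF matrix_vector_mul_linear] matrix_vector_mult_scaleR)
      finally have "(A *v v) \<bullet> b = (\<Sum>c\<in>B. (v \<bullet> c) * ((A *v c) \<bullet> b))"
        by (simp add: inner_sum_left)
      also have "\<dots> = (\<Sum>c\<in>B. if c = b then (v \<bullet> b) * (b \<bullet> (A *v b)) else 0)"
      proof (rule sum.cong[OF refl])
        fix c assume c: "c \<in> B"
        then have "A *v c = (c \<bullet> (A *v c)) *\<^sub>R c" using B by (simp add: orthonormal_eigenbasis_def)
        then have "(A *v c) \<bullet> b = (c \<bullet> (A *v c)) * (c \<bullet> b)" by (metis inner_scaleR_left)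
        then show "(v \<bullet> c) * ((A *v c) \<bullet> b) = (if c = b then (v \<bullet> b) * (b \<bullet> (A *v b)) else 0)"
          using eigenbasis_inner[OF c that(1)] by simp
      qed
      also have "\<dots> = (v \<bullet> b) * (b \<bullet> (A *v b))" using eigenbasis_finite that(1) by simp
      finally have "\<mu> * (v \<bullet> b) = (v \<bullet> b) * (b \<bullet> (A *v b))"
        using v by (simp add: eigenspace_def)
      then show ?thesis using that(2) by auto
    qed
    have "v = (\<Sum>b\<in>B. (v \<bullet> b) *\<^sub>R b)" by (rule eigenbasis_expand)
    also have "\<dots> \<in> span {b\<in>B. b \<bullet> (A *v b) = \<mu>}"
    proof (rule span_sum)
      fix b assume "b \<in> B"
      then show "(v \<bullet> b) *\<^sub>R b \<in> span {b\<in>B. b \<bullet> (A *v b) = \<mu>}"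
        using zero[of b] by (cases "b \<bullet> (A *v b) = \<mu>") (auto intro: span_scale span_base simp: span_zero)
    qed
    finally show "v \<in> span {b\<in>B. b \<bullet> (A *v b) = \<mu>}" .
  qed
qed

text \<open>The basis vectors with negative eigenvalue are grouped by eigenvalue, and each group is
  a basis of its eigenspace.\<close>

lemma matrix_index_eq_card_eigenbasis: "matrix_index A = card {b\<in>B. b \<bullet> (A *v b) < 0}"
proof -
  let ?ev = "\<lambda>b. b \<bullet> (A *v b)" and ?N = "{b\<in>B. b \<bullet> (A *v b) < 0}"
  have dim: "dim (eigenspace A \<mu>) = card {b\<in>B. ?ev b = \<mu>}" for \<mu>
    unfolding eigenspace_eq_span_eigenbasis dim_span
    by (rule dim_eq_card_independent, rule eigenbasis_independent_subset) auto
  have "{\<mu>. \<mu> \<in> eigenvalues A \<and> \<mu> < 0} = ?ev ` ?N"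
  proof (intro set_eqI iffI)
    fix \<mu> assume \<mu>: "\<mu> \<in> {\<mu>. \<mu> \<in> eigenvalues A \<and> \<mu> < 0}"
    then have "span {b\<in>B. ?ev b = \<mu>} \<noteq> {0}"
      by (auto simp: eigenvalues_def eigenspace_eq_span_eigenbasis)
    then have "{b\<in>B. ?ev b = \<mu>} \<noteq> {}" by force
    then show "\<mu> \<in> ?ev ` ?N" using \<mu> by auto
  next
    fix \<mu> assume "\<mu> \<in> ?ev ` ?N"
    then obtain b where b: "b \<in> B" "?ev b = \<mu>" "\<mu> < 0" by auto
    then have "A *v b = \<mu> *\<^sub>R b" "norm b = 1" using B by (auto simp: orthonormal_eigenbasis_def)
    then have "b \<in> eigenspace A \<mu>" "b \<noteq> 0" by (auto simp: eigenspace_def)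
    then show "\<mu> \<in> {\<mu>. \<mu> \<in> eigenvalues A \<and> \<mu> < 0}" using b by (auto simp: eigenvalues_def)
  qed
  then have "matrix_index A = (\<Sum>\<mu>\<in>?ev ` ?N. card {b\<in>B. ?ev b = \<mu>})"
    by (simp add: matrix_index_def dim)
  also have "\<dots> = (\<Sum>\<mu>\<in>?ev ` ?N. card {b\<in>?N. ?ev b = \<mu>})"
    by (intro sum.cong arg_cong[where f = card]) auto
  also have "\<dots> = card ?N"
    using eigenbasis_finite sum.image_gen[of ?N "\<lambda>_. 1::nat" ?ev] by simp
  finally show ?thesis .
qed

end

section \<open>Semicontinuity and local constancy of the index\<close>

lemma norm_matrix_vector_mult_le:
  fixes M :: "real ^ 'n ^ 'm"
  shows "norm (M *v v) \<le> norm M * norm v"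
proof -
  have "norm (M *v v) = L2_set (\<lambda>i. \<bar>M $ i \<bullet> v\<bar>) UNIV"
    by (simp add: norm_vec_def matrix_vector_mul_component)
  also have "\<dots> \<le> L2_set (\<lambda>i. norm (M $ i) * norm v) UNIV"
    by (rule L2_set_mono) (auto intro: Cauchy_Schwarz_ineq2)
  also have "\<dots> = norm M * norm v"
    by (simp add: norm_vec_def[of M] L2_set_left_distrib[symmetric])
  finally show ?thesis .
qed

text \<open>Dimension count as in Sylvester's law of inertia: the form is nonnegative on the span of
  the eigenvectors with nonnegative eigenvalue, so \<open>N\<close> meets that span only in 0 and
  the two dimensions add up to at most \<open>CARD('n)\<close>.\<close>

lemma matrix_index_ge_of_negative_subspace:
  fixes A :: "real ^ 'n ^ 'n"
  assumes sym: "transpose A = A" and N: "subspace N"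
    and neg: "\<And>v. v \<in> N \<Longrightarrow> v \<noteq> 0 \<Longrightarrow> v \<bullet> (A *v v) < 0"
  shows "dim N \<le> matrix_index A"
proof -
  obtain B where B: "orthonormal_eigenbasis A B" using symmetric_matrix_eigenbasis[OF sym] .
  let ?ev = "\<lambda>b. b \<bullet> (A *v b)"
  let ?P = "{b\<in>B. ?ev b \<ge> 0}"
  have ge: "v \<bullet> (A *v v) \<ge> 0" if "v \<in> span ?P" for v
  proof (subst eigenbasis_quadratic_form[OF B], rule sum_nonneg)
    fix b assume "b \<in> B"
    then have "v \<bullet> b = 0" if "\<not> ?ev b \<ge> 0"
      using eigenbasis_inner_span[OF B _ \<open>v \<in> span ?P\<close>] that by blast
    then show "0 \<le> ?ev b * (v \<bullet> b)\<^sup>2" by (cases "?ev b \<ge> 0") auto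
  qed
  have "N \<inter> span ?P \<subseteq> {0}" using neg ge by fastforce
  then have "N \<inter> span ?P = {0}" using N by (auto simp: subspace_0 span_zero)
  then have "dim {x + y |x y. x \<in> N \<and> y \<in> span ?P} = dim N + dim (span ?P)"
    using dim_sums_Int[OF N subspace_span, of ?P] by simp
  moreover have "dim {x + y |x y. x \<in> N \<and> y \<in> span ?P} \<le> CARD('n)"
    by (rule dim_subset_UNIV_cart)
  moreover have "dim (span ?P) = card ?P"
    unfolding dim_span
    by (rule dim_eq_card_independent, rule eigenbasis_independent_subset[OF B]) auto
  moreover have "card ?P + card {b\<in>B. ?ev b < 0} = CARD('n)"
  proof -
    have "card (?P \<union> {b\<in>B. ?ev b < 0}) = card ?P + card {b\<in>B. ?ev b < 0}"
      using eigenbasis_finite[OF B] by (intro card_Un_disjoint) auto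
    moreover have "?P \<union> {b\<in>B. ?ev b < 0} = B" by auto
    ultimately show ?thesis using eigenbasis_card[OF B] by simp
  qed
  ultimately show ?thesis by (simp add: matrix_index_eq_card_eigenbasis[OF B])
qed

text \<open>On the span of the negative eigenvectors the form is at most
  \<open>- e * (v \<bullet> v)\<close>. A perturbation of norm below \<open>e\<close> leaves it
  negative there, so the dimension of that span still bounds the index from below.\<close>

lemma matrix_index_lower_semicontinuous:
  fixes A :: "real ^ 'n ^ 'n"
  assumes sym: "transpose A = A"
  obtains e where "e > 0"
    "\<And>M. transpose M = M \<Longrightarrow> norm (M - A) < e \<Longrightarrow> matrix_index A \<le> matrix_index M"
proof -
  obtain B where B: "orthonormal_eigenbasis A B" using symmetric_matrix_eigenbasis[OF sym] .
  let ?ev = "\<lambda>b. b \<bullet> (A *v b)"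
  define N where "N = {b\<in>B. ?ev b < 0}"
  have "finite N" using eigenbasis_finite[OF B] by (simp add: N_def)
  \<comment> \<open>The entry 1 covers the case without negative eigenvalues, where
    \<open>Min\<close> would be taken over the empty set.\<close>
  define e where "e = Min (insert 1 ((\<lambda>b. - ?ev b) ` N))"
  have e: "e > 0" using \<open>finite N\<close> by (auto simp: e_def N_def)
  have ev: "?ev b \<le> - e" if "b \<in> N" for b
  proof -
    have "e \<le> - ?ev b" unfolding e_def using \<open>finite N\<close> that by (intro Min_le) auto
    then show ?thesis by simp
  qed
  have le: "v \<bullet> (A *v v) \<le> - e * (v \<bullet> v)" if v: "v \<in> span N" for v
  proof -
    have "v \<bullet> (A *v v) \<le> (\<Sum>b\<in>B. - e * (v \<bullet> b)\<^sup>2)"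
    proof (subst eigenbasis_quadratic_form[OF B], rule sum_mono)
      fix b assume b: "b \<in> B"
      show "?ev b * (v \<bullet> b)\<^sup>2 \<le> - e * (v \<bullet> b)\<^sup>2"
      proof (cases "b \<in> N")
        case True
        then show ?thesis using ev[OF True] by (intro mult_right_mono) (assumption, rule zero_le_power2)
      next
        case False
        then have "v \<bullet> b = 0" using eigenbasis_inner_span[OF B _ v] b unfolding N_def by blast
        then show ?thesis by simp
      qed
    qed
    then show ?thesis by (simp add: eigenbasis_norm[OF B, of v] sum_distrib_left)
  qed
  have "matrix_index A \<le> matrix_index M" if M: "transpose M = M" "norm (M - A) < e" for M
  proof -
    have "dim (span N) \<le> matrix_index M"
    proof (rule matrix_index_ge_of_negative_subspace[OF M(1) subspace_span])
      fix v assume v: "v \<in> span N" "v \<noteq> 0"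
      have "v \<bullet> (M *v v) = v \<bullet> (A *v v) + v \<bullet> ((M - A) *v v)"
        by (simp add: matrix_vector_mult_diff_rdistrib inner_diff_right)
      also have "v \<bullet> ((M - A) *v v) \<le> norm v * (norm (M - A) * norm v)"
        using norm_cauchy_schwarz[of v "(M - A) *v v"] norm_matrix_vector_mult_le[of "M - A" v]
        by (meson mult_left_mono norm_ge_zero order_trans)
      also have "\<dots> = norm (M - A) * (v \<bullet> v)" by (simp add: dot_square_norm power2_eq_square)
      also have "\<dots> < e * (v \<bullet> v)" using M(2) v(2) by simp
      finally show "v \<bullet> (M *v v) < 0" using le[OF v(1)] by simp
    qed
    moreover have "dim (span N) = card N"
      unfolding dim_span N_def
      by (rule dim_eq_card_independent, rule eigenbasis_independent_subset[OF B]) auto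
    ultimately show ?thesis by (simp add: matrix_index_eq_card_eigenbasis[OF B] N_def)
  qed
  with e show thesis using that by blast
qed

text \<open>\<open>matrix_index (- A)\<close> counts the positive eigenvalues, so lower bounds for
  it become upper bounds for \<open>matrix_index A\<close>, with zero eigenvalues as the only
  defect.\<close>

lemma matrix_index_add_uminus_le:
  fixes A :: "real ^ 'n ^ 'n"
  assumes sym: "transpose A = A"
  shows "matrix_index A + matrix_index (- A) \<le> CARD('n)"
    and "det A \<noteq> 0 \<Longrightarrow> matrix_index A + matrix_index (- A) = CARD('n)"
proof -
  obtain B where B: "orthonormal_eigenbasis A B" using symmetric_matrix_eigenbasis[OF sym] .
  let ?ev = "\<lambda>b. b \<bullet> (A *v b)"
  have minus: "(- A) *v v = - (A *v v)" for v
    using matrix_vector_mult_diff_rdistrib[of 0 A v] by simp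
  have "orthonormal_eigenbasis (- A) B"
    using B by (auto simp: orthonormal_eigenbasis_def minus)
  then have neg: "matrix_index (- A) = card {b\<in>B. ?ev b > 0}"
    by (simp add: matrix_index_eq_card_eigenbasis minus)
  have sum: "matrix_index A + matrix_index (- A) = card {b\<in>B. ?ev b \<noteq> 0}"
  proof -
    have "card ({b\<in>B. ?ev b < 0} \<union> {b\<in>B. ?ev b > 0}) =
        card {b\<in>B. ?ev b < 0} + card {b\<in>B. ?ev b > 0}"
      using eigenbasis_finite[OF B] by (intro card_Un_disjoint) auto
    moreover have "{b\<in>B. ?ev b < 0} \<union> {b\<in>B. ?ev b > 0} = {b\<in>B. ?ev b \<noteq> 0}" by auto
    ultimately show ?thesis by (simp add: neg matrix_index_eq_card_eigenbasis[OF B])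
  qed
  then show "matrix_index A + matrix_index (- A) \<le> CARD('n)"
    using eigenbasis_finite[OF B] eigenbasis_card[OF B] by (metis (no_types, lifting) card_mono mem_Collect_eq subsetI)
  assume det: "det A \<noteq> 0"
  have "{b\<in>B. ?ev b \<noteq> 0} = B"
  proof (intro set_eqI iffI)
    fix b assume b: "b \<in> B"
    then have "A *v b = ?ev b *\<^sub>R b" "b \<noteq> 0" using B by (auto simp: orthonormal_eigenbasis_def)
    moreover have "A *v b \<noteq> 0"
      using det \<open>b \<noteq> 0\<close> by (metis invertible_det_nz invertible_left_inverse matrix_left_invertible_ker)
    ultimately show "b \<in> {b\<in>B. ?ev b \<noteq> 0}" using b by auto
  qed auto
  then show "matrix_index A + matrix_index (- A) = CARD('n)" using sum eigenbasis_card[OF B] by simp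
qed

text \<open>The indices of \<open>A\<close> and \<open>- A\<close> are both lower semicontinuous. At
  a nonsingular \<open>A\<close> their sum already has its maximal value \<open>CARD('n)\<close>, so
  neither can increase nearby.\<close>

lemma matrix_index_locally_constant:
  fixes A :: "real ^ 'n ^ 'n"
  assumes sym: "transpose A = A" and det: "det A \<noteq> 0"
  obtains e where "e > 0"
    "\<And>M. transpose M = M \<Longrightarrow> norm (M - A) < e \<Longrightarrow> matrix_index M = matrix_index A"
proof -
  have tr: "transpose (- M) = - M" if "transpose M = M" for M :: "real ^ 'n ^ 'n"
    using that by (simp add: transpose_def vec_eq_iff)
  obtain e1 where e1: "e1 > 0"
    "\<And>M. transpose M = M \<Longrightarrow> norm (M - A) < e1 \<Longrightarrow> matrix_index A \<le> matrix_index M"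
    using matrix_index_lower_semicontinuous[OF sym] by blast
  obtain e2 where e2: "e2 > 0"
    "\<And>M. transpose M = M \<Longrightarrow> norm (M - (- A)) < e2 \<Longrightarrow> matrix_index (- A) \<le> matrix_index M"
    using matrix_index_lower_semicontinuous[OF tr[OF sym]] by blast
  have "matrix_index M = matrix_index A" if M: "transpose M = M" "norm (M - A) < min e1 e2" for M
  proof -
    have "norm (- M - (- A)) < e2" using M(2) by (simp add: norm_minus_commute)
    then have "matrix_index (- A) \<le> matrix_index (- M)" using e2(2)[OF tr[OF M(1)]] by simp
    moreover have "matrix_index A \<le> matrix_index M" using e1(2)[OF M(1)] M(2) by simp
    ultimately show ?thesis
      using matrix_index_add_uminus_le(1)[OF M(1)] matrix_index_add_uminus_le(2)[OF sym det] by simp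
  qed
  then show thesis using that[of "min e1 e2"] e1(1) e2(1) by simp
qed

text \<open>Index at least \<open>k\<close> is a relatively open condition on symmetric matrices,
  and an open set of a metric space is a countable union of closed ones; index exactly
  \<open>l\<close> removes one more open set. Closed pieces are what \<open>sets_Bex_closed\<close>
  accepts.\<close>

lemma closed_cover_symmetric_matrix_index:
  obtains C :: "nat \<Rightarrow> (real ^ 'n ^ 'n) set"
  where "\<And>m. closed (C m)" "{A. transpose A = A \<and> matrix_index A = l} = (\<Union>m. C m)"
proof -
  define Sym where "Sym = {A :: real ^ 'n ^ 'n. transpose A = A}"
  have clSym: "closed Sym"
    unfolding Sym_def by (rule closed_Collect_eq) (auto simp: transpose_def intro!: continuous_intros)
  \<comment> \<open>Semicontinuity compares symmetric matrices only. \<open>V k\<close> is open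
    among all matrices, and its trace on \<open>Sym\<close> is the wanted set.\<close>
  define V where "V k = \<Union>{ball A e | A e. A \<in> Sym \<and> (\<forall>M\<in>Sym. dist A M < e \<longrightarrow> k \<le> matrix_index M)}" for k
  have opV: "open (V k)" for k unfolding V_def by (intro open_Union) auto
  have V: "Sym \<inter> V k = {A \<in> Sym. k \<le> matrix_index A}" for k
  proof (intro set_eqI iffI)
    fix A assume A: "A \<in> {A \<in> Sym. k \<le> matrix_index A}"
    then obtain e where "e > 0"
      "\<And>M. transpose M = M \<Longrightarrow> norm (M - A) < e \<Longrightarrow> matrix_index A \<le> matrix_index M"
      using matrix_index_lower_semicontinuous[of A] by (auto simp: Sym_def)
    then have "\<forall>M\<in>Sym. dist A M < e \<longrightarrow> k \<le> matrix_index M"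
      using A by (auto simp: Sym_def dist_norm norm_minus_commute intro: order_trans)
    then have "ball A e \<subseteq> V k" using A unfolding V_def by blast
    then show "A \<in> Sym \<inter> V k" using A \<open>e > 0\<close> by auto
  qed (auto simp: V_def)
  have "fsigma_in euclidean (V l)"
    by (simp add: open_imp_fsigma_in metrizable_space_euclidean opV)
  then obtain F :: "nat \<Rightarrow> (real ^ 'n ^ 'n) set" where F: "\<And>m. closed (F m)" "V l = (\<Union>m. F m)"
    unfolding fsigma_in_ascending closed_closedin[symmetric] by metis
  show thesis
  proof (rule that[of "\<lambda>m. F m \<inter> (Sym - V (Suc l))"])
    show "closed (F m \<inter> (Sym - V (Suc l)))" for m
      using F(1) clSym opV by (intro closed_Int closed_Diff) auto
    have "{A. transpose A = A \<and> matrix_index A = l} = (Sym \<inter> V l) - (Sym \<inter> V (Suc l))"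
      unfolding V by (auto simp: Sym_def)
    also have "\<dots> = (\<Union>m. F m \<inter> (Sym - V (Suc l)))" using F(2) by auto
    finally show "{A. transpose A = A \<and> matrix_index A = l} = (\<Union>m. F m \<inter> (Sym - V (Suc l)))" .
  qed
qed

section \<open>Calculus on the unit cube\<close>

lemma partial_deriv_eqI:
  assumes "t \<in> unit_cube" "(f has_derivative f') (at t within unit_cube)"
  shows "partial_deriv i f t = f' (axis i 1)"
  unfolding partial_deriv_def using assms
  by (subst frechet_derivative_within_cbox) (auto simp: Basis_vec_def inner_axis)

lemma partial_deriv_cong:
  assumes "t \<in> unit_cube" "\<And>s. s \<in> unit_cube \<Longrightarrow> f s = g s"
  shows "partial_deriv i f t = partial_deriv i g t"
proof -
  have "(f has_derivative D) (at t within unit_cube) \<longleftrightarrow> (g has_derivative D) (at t within unit_cube)" for D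
    using assms has_derivative_transform[of t unit_cube f g D] has_derivative_transform[of t unit_cube g f D]
    by auto
  then show ?thesis unfolding partial_deriv_def frechet_derivative_def by simp
qed

lemma has_derivative_gradient:
  assumes "f differentiable_on unit_cube" "t \<in> unit_cube"
  shows "(f has_derivative (\<lambda>v. gradient f t \<bullet> v)) (at t within unit_cube)"
proof -
  obtain D where D: "(f has_derivative D) (at t within unit_cube)"
    using assms by (auto simp: differentiable_on_def differentiable_def)
  then have lin: "linear D" using has_derivative_linear by blast
  have "D v = gradient f t \<bullet> v" for v
  proof -
    have "D v = D (\<Sum>i\<in>UNIV. v $ i *\<^sub>R axis i 1)"
      using basis_expansion[of v] by (simp add: scalar_mult_eq_scaleR)
    also have "\<dots> = (\<Sum>i\<in>UNIV. v $ i * D (axis i 1))"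
      by (simp add: linear_sum[OF lin] linear_cmul[OF lin])
    finally show ?thesis
      by (simp add: inner_vec_def gradient_def partial_deriv_eqI[OF assms(2) D] mult.commute)
  qed
  then have "D = (\<lambda>v. gradient f t \<bullet> v)" by (rule ext)
  with D show ?thesis by simp
qed

lemma partial_deriv_diff:
  assumes "f differentiable_on unit_cube" "g differentiable_on unit_cube" "t \<in> unit_cube"
  shows "partial_deriv i (\<lambda>t. f t - g t) t = partial_deriv i f t - partial_deriv i g t"
proof -
  have "((\<lambda>t. f t - g t) has_derivative (\<lambda>v. gradient f t \<bullet> v - gradient g t \<bullet> v)) (at t within unit_cube)"
    by (intro has_derivative_diff has_derivative_gradient assms)
  from partial_deriv_eqI[OF assms(3) this] show ?thesis by (simp add: gradient_def inner_axis)
qed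

lemma partial_deriv_partial_deriv_diff:
  assumes "f \<in> C2_functions" "g \<in> C2_functions" "t \<in> unit_cube"
  shows "partial_deriv i (partial_deriv j (\<lambda>t. f t - g t)) t =
    partial_deriv i (partial_deriv j f) t - partial_deriv i (partial_deriv j g) t"
proof -
  have "partial_deriv i (partial_deriv j (\<lambda>t. f t - g t)) t =
      partial_deriv i (\<lambda>t. partial_deriv j f t - partial_deriv j g t) t"
    using assms by (intro partial_deriv_cong partial_deriv_diff) (auto simp: C2_functions_def)
  also have "\<dots> = partial_deriv i (partial_deriv j f) t - partial_deriv i (partial_deriv j g) t"
    using assms by (intro partial_deriv_diff) (auto simp: C2_functions_def)
  finally show ?thesis .
qed

lemma C2_functions_diff:
  assumes f: "f \<in> C2_functions" and g: "g \<in> C2_functions"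
  shows "(\<lambda>t. f t - g t) \<in> C2_functions"
  unfolding C2_functions_def
proof (intro CollectI conjI allI)
  show "(\<lambda>t. f t - g t) differentiable_on unit_cube"
    using f g by (auto simp: C2_functions_def)
  fix i j :: 'a
  show "partial_deriv i (\<lambda>t. f t - g t) differentiable_on unit_cube"
    unfolding differentiable_on_def
  proof
    fix t :: "real ^ 'a" assume t: "t \<in> unit_cube"
    have "(\<lambda>t. partial_deriv i f t - partial_deriv i g t) differentiable (at t within unit_cube)"
      using f g t by (auto simp: C2_functions_def differentiable_on_def)
    then obtain D where
      "((\<lambda>t. partial_deriv i f t - partial_deriv i g t) has_derivative D) (at t within unit_cube)"
      by (auto simp: differentiable_def)
    then have "(partial_deriv i (\<lambda>t. f t - g t) has_derivative D) (at t within unit_cube)"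
      using t f g by (elim has_derivative_transform[rotated 2]) (auto simp: partial_deriv_diff C2_functions_def)
    then show "partial_deriv i (\<lambda>t. f t - g t) differentiable (at t within unit_cube)"
      by (auto simp: differentiable_def)
  qed
  have "continuous_on unit_cube (\<lambda>t. partial_deriv i (partial_deriv j f) t - partial_deriv i (partial_deriv j g) t)"
    using f g by (auto simp: C2_functions_def intro!: continuous_intros)
  then show "continuous_on unit_cube (partial_deriv i (partial_deriv j (\<lambda>t. f t - g t)))"
    by (rule continuous_on_eq) (simp add: partial_deriv_partial_deriv_diff[OF f g])
qed

section \<open>Symmetry of the Hessian\<close>

text \<open>One-variable reduction that also works from boundary points: the segment only has to
  stay in the cube, and one-sided derivatives are used at its ends.\<close>

lemma has_derivative_along_line:
  assumes f: "f differentiable_on unit_cube"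
    and line: "\<And>s. s \<in> {0..c} \<Longrightarrow> p + s *\<^sub>R v \<in> unit_cube" and u: "u \<in> {0..c}"
  shows "((\<lambda>s. f (p + s *\<^sub>R v)) has_derivative (\<lambda>h. h * (gradient f (p + u *\<^sub>R v) \<bullet> v))) (at u within {0..c})"
proof -
  have "((\<lambda>s. f (p + s *\<^sub>R v)) has_derivative (\<lambda>h. gradient f (p + u *\<^sub>R v) \<bullet> (h *\<^sub>R v))) (at u within {0..c})"
  proof (rule has_derivative_in_compose2[where t = unit_cube])
    show "(f has_derivative (\<lambda>h. gradient f x \<bullet> h)) (at x within unit_cube)" if "x \<in> unit_cube" for x
      by (rule has_derivative_gradient[OF f that])
    show "((\<lambda>s. p + s *\<^sub>R v) has_derivative (\<lambda>h. h *\<^sub>R v)) (at u within {0..c})"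
      by (auto intro!: derivative_eq_intros)
  qed (use line u in auto)
  then show ?thesis by simp
qed

text \<open>Mean value theorem twice: in direction \<open>v\<close> for the increment of
  \<open>f\<close> under a shift by \<open>c *\<^sub>R w\<close>, then in direction \<open>w\<close>
  for \<open>partial_deriv i f\<close>. Exchanging the directions expresses the same second
  difference by the other mixed derivative.\<close>

lemma second_difference_eq_partial_deriv:
  fixes t :: "real ^ 'd" and i j :: 'd and \<sigma> \<tau> :: real
  defines "v \<equiv> \<sigma> *\<^sub>R axis i 1" and "w \<equiv> \<tau> *\<^sub>R axis j 1"
  assumes f: "f \<in> C2_functions" and c: "c > 0"
    and box: "\<And>a b. a \<in> {0..c} \<Longrightarrow> b \<in> {0..c} \<Longrightarrow> t + a *\<^sub>R v + b *\<^sub>R w \<in> unit_cube"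
  obtains a b where "a \<in> {0..c}" "b \<in> {0..c}"
    "f (t + c *\<^sub>R v + c *\<^sub>R w) - f (t + c *\<^sub>R v) - f (t + c *\<^sub>R w) + f t =
       c * c * \<sigma> * \<tau> * partial_deriv j (partial_deriv i f) (t + a *\<^sub>R v + b *\<^sub>R w)"
proof -
  have df: "f differentiable_on unit_cube" "partial_deriv i f differentiable_on unit_cube"
    using f by (auto simp: C2_functions_def)
  let ?F = "\<lambda>a. f (t + c *\<^sub>R w + a *\<^sub>R v) - f (t + a *\<^sub>R v)"
  have box0: "t + a *\<^sub>R v \<in> unit_cube" if "a \<in> {0..c}" for a
    using box[OF that, of 0] c by simp
  have boxc: "t + c *\<^sub>R w + a *\<^sub>R v \<in> unit_cube" if "a \<in> {0..c}" for a
    using box[OF that, of c] c by (simp add: algebra_simps)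
  have "\<exists>a\<in>{0<..<c}. ?F c - ?F 0 =
      (c - 0) * (gradient f (t + c *\<^sub>R w + a *\<^sub>R v) \<bullet> v) - (c - 0) * (gradient f (t + a *\<^sub>R v) \<bullet> v)"
    using c by (intro mvt_simple has_derivative_diff has_derivative_along_line[OF df(1)] box0 boxc) auto
  then obtain a where "a \<in> {0<..<c}" and F: "?F c - ?F 0 =
      (c - 0) * (gradient f (t + c *\<^sub>R w + a *\<^sub>R v) \<bullet> v) - (c - 0) * (gradient f (t + a *\<^sub>R v) \<bullet> v)"
    by blast
  then have a: "a \<in> {0..c}" by simp
  have grad_v: "gradient f p \<bullet> v = \<sigma> * partial_deriv i f p" for p
    by (simp add: v_def gradient_def inner_axis)
  let ?G = "\<lambda>b. partial_deriv i f (t + a *\<^sub>R v + b *\<^sub>R w)"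
  have "\<exists>b\<in>{0<..<c}. ?G c - ?G 0 = (c - 0) * (gradient (partial_deriv i f) (t + a *\<^sub>R v + b *\<^sub>R w) \<bullet> w)"
    using c a by (intro mvt_simple has_derivative_along_line[OF df(2)] box) auto
  then obtain b where "b \<in> {0<..<c}"
    and "?G c - ?G 0 = (c - 0) * (gradient (partial_deriv i f) (t + a *\<^sub>R v + b *\<^sub>R w) \<bullet> w)"
    by blast
  then have b: "b \<in> {0..c}"
    and G: "?G c - ?G 0 = c * \<tau> * partial_deriv j (partial_deriv i f) (t + a *\<^sub>R v + b *\<^sub>R w)"
    by (auto simp: w_def gradient_def[of "partial_deriv i f"] inner_axis)
  have "f (t + c *\<^sub>R v + c *\<^sub>R w) - f (t + c *\<^sub>R v) - f (t + c *\<^sub>R w) + f t = c * \<sigma> * (?G c - ?G 0)"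
    using F unfolding grad_v by (simp add: algebra_simps)
  then show thesis
    using that[OF a b] G by simp
qed

text \<open>Schwarz's theorem up to the boundary: one second difference gives, up to the same
  factor, both mixed derivatives at two points of a shrinking rectangle, and continuity moves both
  points to \<open>t\<close>.\<close>

lemma mixed_partial_derivs_commute:
  fixes t :: "real ^ 'd"
  assumes f: "f \<in> C2_functions" and t: "t \<in> unit_cube"
  shows "partial_deriv i (partial_deriv j f) t = partial_deriv j (partial_deriv i f) t"
proof (cases "i = j")
  case False
  let ?P = "partial_deriv i (partial_deriv j f)" and ?Q = "partial_deriv j (partial_deriv i f)"
  \<comment> \<open>The signs keep the second differences inside the cube, so that boundary points need no separate treatment.\<close>
  define sg :: "'d \<Rightarrow> real" where "sg k = (if t $ k \<le> 1 / 2 then 1 else - 1)" for k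
  let ?p = "\<lambda>a b. t + a *\<^sub>R (sg i *\<^sub>R axis i 1) + b *\<^sub>R (sg j *\<^sub>R axis j 1)"
  \<comment> \<open>Each of the two coordinates moves by at most 1/2 towards the farther face, and
    \<open>i\<close> and \<open>j\<close> differ, so none is moved twice.\<close>
  have in_cube: "?p a b \<in> unit_cube" if "a \<in> {0..1/2}" "b \<in> {0..1/2}" for a b
    unfolding mem_box_cart
  proof
    fix k
    have k: "0 \<le> t $ k" "t $ k \<le> 1" using t by (auto simp: mem_box_cart)
    show "(0::real ^ 'd) $ k \<le> ?p a b $ k \<and> ?p a b $ k \<le> (1::real ^ 'd) $ k"
      using that k False by (auto simp: axis_def sg_def)
  qed
  have near: "dist (?p a b) t \<le> 2 * c" if "a \<in> {0..c}" "b \<in> {0..c}" for a b c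
  proof -
    have "norm (a *\<^sub>R (sg i *\<^sub>R axis i (1::real) :: real ^ 'd) + b *\<^sub>R (sg j *\<^sub>R axis j 1)) \<le> \<bar>a\<bar> + \<bar>b\<bar>"
      by (rule order_trans[OF norm_triangle_ineq]) (auto simp: sg_def norm_axis_1)
    then show ?thesis using that by (simp add: dist_norm algebra_simps)
  qed
  have "\<bar>?P t - ?Q t\<bar> < 2 * e" if "e > 0" for e
  proof -
    have cont: "continuous_on unit_cube ?P" "continuous_on unit_cube ?Q"
      using f by (auto simp: C2_functions_def)
    obtain d1 where d1: "d1 > 0" "\<And>s. s \<in> unit_cube \<Longrightarrow> dist s t < d1 \<Longrightarrow> dist (?P s) (?P t) < e"
      using cont(1) t \<open>e > 0\<close> unfolding continuous_on_iff by meson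
    obtain d2 where d2: "d2 > 0" "\<And>s. s \<in> unit_cube \<Longrightarrow> dist s t < d2 \<Longrightarrow> dist (?Q s) (?Q t) < e"
      using cont(2) t \<open>e > 0\<close> unfolding continuous_on_iff by meson
    \<comment> \<open>The bound 1/2 keeps the rectangle in the cube; dividing by 3 makes the
      distance bound \<open>2 * c\<close> from \<open>near\<close> strictly smaller than
      \<open>d1\<close> and \<open>d2\<close>.\<close>
    define c where "c = min (1/2) (min d1 d2 / 3)"
    have c: "c > 0" "c \<le> 1/2" "2 * c < d1" "2 * c < d2" using d1(1) d2(1) by (auto simp: c_def min_def)
    obtain a b where ab: "a \<in> {0..c}" "b \<in> {0..c}"
      "f (?p c c) - f (t + c *\<^sub>R (sg i *\<^sub>R axis i 1)) - f (t + c *\<^sub>R (sg j *\<^sub>R axis j 1)) + f t =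
       c * c * sg i * sg j * ?Q (?p a b)"
      using c in_cube by (rule_tac second_difference_eq_partial_deriv[OF f, of c t "sg i" i "sg j" j]) auto
    obtain b' a' where ab': "b' \<in> {0..c}" "a' \<in> {0..c}"
      "f (t + c *\<^sub>R (sg j *\<^sub>R axis j 1) + c *\<^sub>R (sg i *\<^sub>R axis i 1)) - f (t + c *\<^sub>R (sg j *\<^sub>R axis j 1)) -
       f (t + c *\<^sub>R (sg i *\<^sub>R axis i 1)) + f t =
       c * c * sg j * sg i * ?P (t + b' *\<^sub>R (sg j *\<^sub>R axis j 1) + a' *\<^sub>R (sg i *\<^sub>R axis i 1))"
    proof (rule second_difference_eq_partial_deriv[OF f, of c t "sg j" j "sg i" i])
      fix b a assume "b \<in> {0..c}" "a \<in> {0..c}"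
      then show "t + b *\<^sub>R (sg j *\<^sub>R axis j 1) + a *\<^sub>R (sg i *\<^sub>R axis i 1) \<in> unit_cube"
        using in_cube[of a b] c by (simp add: add_ac)
    qed (use c in auto)
    have swap: "t + b *\<^sub>R (sg j *\<^sub>R axis j 1) + a *\<^sub>R (sg i *\<^sub>R axis i 1) = ?p a b" for a b
      by (simp add: add_ac)
    have "c * c * sg i * sg j * ?Q (?p a b) = c * c * sg j * sg i * ?P (?p a' b')"
      using ab(3) ab'(3) unfolding swap by linarith
    then have eq: "?Q (?p a b) = ?P (?p a' b')" using c by (auto simp: sg_def split: if_splits)
    have "dist (?Q (?p a b)) (?Q t) < e"
      using c ab near[OF ab(1,2)] by (intro d2 in_cube) auto
    moreover have "dist (?P (?p a' b')) (?P t) < e"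
      using c ab' near[OF ab'(2,1)] by (intro d1 in_cube) auto
    ultimately show ?thesis using eq by (simp add: dist_real_def)
  qed
  from this[of "\<bar>?P t - ?Q t\<bar> / 2"] show ?thesis by fastforce
qed simp

lemma transpose_hessian:
  "f \<in> C2_functions \<Longrightarrow> t \<in> unit_cube \<Longrightarrow> transpose (hessian f t) = hessian f t"
  by (simp add: transpose_def hessian_def vec_eq_iff mixed_partial_derivs_commute)

text \<open>With its index order, \<open>hessian\<close> is the transpose of the Jacobian of the
  gradient; symmetry of the second derivatives removes the difference.\<close>

lemma gradient_has_derivative_hessian:
  assumes f: "f \<in> C2_functions" and t: "t \<in> unit_cube"
  shows "(gradient f has_derivative (\<lambda>v. hessian f t *v v)) (at t within unit_cube)"
proof -
  have "((\<lambda>t. gradient f t $ j) has_derivative (\<lambda>v. (hessian f t *v v) $ j)) (at t within unit_cube)" for j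
  proof -
    have "(partial_deriv j f has_derivative (\<lambda>v. gradient (partial_deriv j f) t \<bullet> v)) (at t within unit_cube)"
      using f t by (intro has_derivative_gradient) (auto simp: C2_functions_def)
    moreover have "gradient (partial_deriv j f) t \<bullet> v = (hessian f t *v v) $ j" for v
      using mixed_partial_derivs_commute[OF f t]
      by (simp add: gradient_def[of "partial_deriv j f"] hessian_def matrix_vector_mult_def inner_vec_def)
    ultimately show ?thesis by (simp add: gradient_def[of f])
  qed
  then show ?thesis
    by (subst has_derivative_componentwise_within) (auto simp: Basis_vec_def inner_axis)
qed

lemma continuous_on_gradient: "f \<in> C2_functions \<Longrightarrow> continuous_on unit_cube (gradient f)"
  by (rule has_derivative_continuous_on) (rule gradient_has_derivative_hessian)

lemma continuous_on_hessian: "f \<in> C2_functions \<Longrightarrow> continuous_on unit_cube (hessian f)"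
  unfolding hessian_def by (auto simp: C2_functions_def intro!: continuous_intros)

section \<open>The norm controls gradient and Hessian\<close>

text \<open>\<open>multi_deriv\<close> differentiates along a list picked by choice; all that is
  known of that list is that it permutes \<open>js\<close>.\<close>

lemma multi_deriv_count_list:
  obtains ks where "mset ks = mset js" "multi_deriv (count_list js) f = foldr partial_deriv ks f"
proof -
  let ?ks = "SOME ks. \<forall>i. count_list ks i = count_list js i"
  have "\<forall>i. count_list ?ks i = count_list js i" by (rule someI[of _ js]) simp
  then have "mset ?ks = mset js" by (simp add: multiset_eq_iff count_mset)
  with that[of ?ks] show thesis by (simp add: multi_deriv_def)
qed

lemma sum_count_list_UNIV: "(\<Sum>i\<in>UNIV. count_list js (i::'d::finite)) = length js"
  by (metis finite_code sum_count_set top_greatest)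

lemma multi_index_eq_count_list:
  fixes \<alpha> :: "'d::finite \<Rightarrow> nat"
  obtains js where "\<alpha> = count_list js" "length js = (\<Sum>i\<in>UNIV. \<alpha> i)"
proof -
  obtain js where js: "mset js = Abs_multiset \<alpha>" using ex_mset by blast
  then have \<alpha>: "\<alpha> = count_list js" by (simp add: fun_eq_iff count_mset[symmetric] count_Abs_multiset)
  then show thesis using that by (simp add: sum_count_list_UNIV)
qed

lemma continuous_on_multi_deriv:
  fixes f :: "real ^ 'd \<Rightarrow> real"
  assumes f: "f \<in> C2_functions" and \<alpha>: "(\<Sum>i\<in>UNIV. \<alpha> i) \<le> 2"
  shows "continuous_on unit_cube (multi_deriv \<alpha> f)"
proof -
  obtain js where js: "\<alpha> = count_list js" "length js = (\<Sum>i\<in>UNIV. \<alpha> i)"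
    by (rule multi_index_eq_count_list)
  obtain ks where ks: "mset ks = mset js" "multi_deriv \<alpha> f = foldr partial_deriv ks f"
    unfolding js(1) by (rule multi_deriv_count_list)
  have "length ks \<le> 2" using \<alpha> js(2) ks(1) by (metis size_mset)
  then consider "ks = []" | i where "ks = [i]" | i j where "ks = [i, j]"
    by (cases ks rule: remdups_adj.cases) auto
  then show ?thesis
  proof cases
    case 1
    then show ?thesis using f ks(2) by (simp add: C2_functions_def differentiable_imp_continuous_on)
  next
    case 2
    then show ?thesis using f ks(2) by (simp add: C2_functions_def differentiable_imp_continuous_on)
  next
    case 3
    then show ?thesis using f ks(2) by (simp add: C2_functions_def)
  qed
qed

text \<open>Two defaults have to be excluded: an infinite \<open>sum\<close> is 0 and an unbounded
  \<open>SUP\<close> is unspecified. Multi-indices have entries at most 2, and the derivatives are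
  continuous on a compact cube.\<close>

lemma abs_multi_deriv_le_C2_norm:
  fixes f :: "real ^ 'd \<Rightarrow> real"
  assumes f: "f \<in> C2_functions" and \<alpha>: "(\<Sum>i\<in>UNIV. \<alpha> i) \<le> 2" and t: "t \<in> unit_cube"
  shows "\<bar>multi_deriv \<alpha> f t\<bar> \<le> C2_norm f"
proof -
  let ?I = "{\<alpha> :: 'd \<Rightarrow> nat. (\<Sum>i\<in>UNIV. \<alpha> i) \<le> 2}"
  have "?I \<subseteq> (UNIV \<rightarrow>\<^sub>E {..2})"
  proof
    fix \<beta> assume "\<beta> \<in> ?I"
    moreover have "\<beta> k \<le> (\<Sum>i\<in>UNIV. \<beta> i)" for k by (rule member_le_sum) auto
    ultimately show "\<beta> \<in> UNIV \<rightarrow>\<^sub>E {..2}" by (auto intro: order_trans)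
  qed
  then have fin: "finite ?I" by (rule finite_subset) (simp add: finite_PiE)
  have le: "\<bar>multi_deriv \<beta> f t\<bar> \<le> (SUP t\<in>unit_cube. \<bar>multi_deriv \<beta> f t\<bar>)"
    if "\<beta> \<in> ?I" for \<beta>
  proof (rule cSUP_upper[OF t])
    have "compact ((\<lambda>t. \<bar>multi_deriv \<beta> f t\<bar>) ` unit_cube)"
      using that f by (intro compact_continuous_image continuous_intros continuous_on_multi_deriv) auto
    then show "bdd_above ((\<lambda>t. \<bar>multi_deriv \<beta> f t\<bar>) ` unit_cube)"
      by (intro bounded_imp_bdd_above compact_imp_bounded)
  qed
  have "\<bar>multi_deriv \<alpha> f t\<bar> \<le> (SUP t\<in>unit_cube. \<bar>multi_deriv \<alpha> f t\<bar>)" using le \<alpha> by simp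
  also have "\<dots> \<le> C2_norm f"
    unfolding C2_norm_def
    by (rule member_le_sum[of \<alpha> ?I "\<lambda>\<alpha>. SUP t\<in>unit_cube. \<bar>multi_deriv \<alpha> f t\<bar>"])
      (use fin \<alpha> le in \<open>auto intro: order_trans[OF abs_ge_zero]\<close>)
  finally show ?thesis .
qed

lemma abs_partial_deriv_le_C2_norm:
  assumes f: "f \<in> C2_functions" and t: "t \<in> unit_cube"
  shows "\<bar>partial_deriv i f t\<bar> \<le> C2_norm f"
    and "\<bar>partial_deriv i (partial_deriv j f) t\<bar> \<le> C2_norm f"
proof -
  obtain ks where ks: "mset ks = mset [i]" "multi_deriv (count_list [i]) f = foldr partial_deriv ks f"
    by (rule multi_deriv_count_list)
  then have "ks = [i]" by simp
  with ks show "\<bar>partial_deriv i f t\<bar> \<le> C2_norm f"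
    using abs_multi_deriv_le_C2_norm[OF f _ t, of "count_list [i]"] by (simp only: sum_count_list_UNIV) simp
  obtain js where js: "mset js = mset [i, j]" "multi_deriv (count_list [i, j]) f = foldr partial_deriv js f"
    by (rule multi_deriv_count_list)
  from js(1) have "length js = 2" by (metis length_Cons list.size(3) numeral_2_eq_2 size_mset)
  then obtain a b where ab: "js = [a, b]" by (auto simp: length_Suc_conv numeral_2_eq_2)
  \<comment> \<open>The chosen order may be either one; symmetry of the second derivatives makes
    both agree.\<close>
  with js(1) have "(a = i \<and> b = j) \<or> (a = j \<and> b = i)"
    by (auto simp: add_eq_conv_ex)
  with ab js(2) mixed_partial_derivs_commute[OF f t, of i j]
  have "multi_deriv (count_list [i, j]) f t = partial_deriv i (partial_deriv j f) t" by auto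
  then show "\<bar>partial_deriv i (partial_deriv j f) t\<bar> \<le> C2_norm f"
    using abs_multi_deriv_le_C2_norm[OF f _ t, of "count_list [i, j]"] by (simp only: sum_count_list_UNIV) simp
qed

text \<open>The l1 bound gives the factor \<open>CARD('d)\<close>. It is enlarged to the square that
  arises for the Hessian, so that one constant serves both in
  \<open>C2_convergence_uniform\<close>.\<close>

lemma norm_gradient_diff_le:
  fixes f :: "real ^ 'd \<Rightarrow> real"
  assumes f: "f \<in> C2_functions" and g: "g \<in> C2_functions" and t: "t \<in> unit_cube"
  shows "norm (gradient g t - gradient f t) \<le> real CARD('d) ^ 2 * C2_norm (\<lambda>t. g t - f t)"
proof -
  let ?N = "C2_norm (\<lambda>t. g t - f t)"
  have "\<bar>(gradient g t - gradient f t) $ i\<bar> \<le> ?N" for i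
    using abs_partial_deriv_le_C2_norm(1)[OF C2_functions_diff[OF g f] t, of i] f g t
    by (simp add: gradient_def partial_deriv_diff C2_functions_def)
  then have "(\<Sum>i\<in>UNIV. \<bar>(gradient g t - gradient f t) $ i\<bar>) \<le> (\<Sum>i::'d\<in>UNIV. ?N)"
    by (intro sum_mono)
  moreover have "0 \<le> ?N"
    using abs_partial_deriv_le_C2_norm(1)[OF C2_functions_diff[OF g f] t] by (meson abs_ge_zero order_trans)
  then have "real CARD('d) * ?N \<le> real CARD('d) ^ 2 * ?N"
    by (intro mult_right_mono) (auto simp: power2_eq_square)
  ultimately show ?thesis
    using norm_le_l1_cart[of "gradient g t - gradient f t"] by simp
qed

lemma norm_hessian_diff_le:
  fixes f :: "real ^ 'd \<Rightarrow> real"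
  assumes f: "f \<in> C2_functions" and g: "g \<in> C2_functions" and t: "t \<in> unit_cube"
  shows "norm (hessian g t - hessian f t) \<le> real CARD('d) ^ 2 * C2_norm (\<lambda>t. g t - f t)"
proof -
  let ?N = "C2_norm (\<lambda>t. g t - f t)" and ?D = "hessian g t - hessian f t"
  have "\<bar>?D $ i $ j\<bar> \<le> ?N" for i j
    using abs_partial_deriv_le_C2_norm(2)[OF C2_functions_diff[OF g f] t, of i j]
    by (simp add: hessian_def partial_deriv_partial_deriv_diff[OF g f t])
  then have "(\<Sum>j\<in>UNIV. \<bar>?D $ i $ j\<bar>) \<le> (\<Sum>j::'d\<in>UNIV. ?N)" for i
    by (intro sum_mono)
  then have row: "norm (?D $ i) \<le> real CARD('d) * ?N" for i
    using norm_le_l1_cart[of "?D $ i"] by (simp add: order_trans)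
  have "norm ?D \<le> (\<Sum>i\<in>UNIV. norm (?D $ i))"
    unfolding norm_vec_def[of ?D] by (rule L2_set_le_sum) simp
  also have "\<dots> \<le> (\<Sum>i::'d\<in>UNIV. real CARD('d) * ?N)" by (intro sum_mono row)
  finally show ?thesis by (simp add: power2_eq_square mult.assoc)
qed

section \<open>Stability of nondegenerate critical points\<close>

text \<open>Convergence asks for a single sequence of selectors, while the hypothesis gives points
  for each radius separately. Choosing a nearest point of \<open>F n\<close> is independent of
  \<open>r\<close> and serves all radii at once.\<close>

lemma set_convergesI:
  fixes S :: "(real ^ 'd) set"
  assumes fin: "finite S"
    and ev: "\<And>r. r > 0 \<Longrightarrow> \<forall>\<^sub>F n in sequentially. finite (F n) \<and> card (F n) = card S \<and> (\<forall>x\<in>S. \<exists>y\<in>F n. dist y x \<le> r)"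
  shows "set_converges F S"
proof -
  define \<phi> where "\<phi> n x = (SOME y. y \<in> F n \<and> infdist x (F n) = dist x y)" for n x
  have \<phi>: "\<forall>x\<in>S. \<phi> n x \<in> F n \<and> dist (\<phi> n x) x \<le> r"
    if n: "finite (F n) \<and> card (F n) = card S \<and> (\<forall>x\<in>S. \<exists>y\<in>F n. dist y x \<le> r)" for n r
  proof
    fix x assume "x \<in> S"
    then obtain y where y: "y \<in> F n" "dist y x \<le> r" using n by blast
    then have "\<exists>y. y \<in> F n \<and> infdist x (F n) = dist x y"
      using infdist_attains_inf[of "F n" x] n finite_imp_closed by blast
    then have "\<phi> n x \<in> F n \<and> infdist x (F n) = dist x (\<phi> n x)" unfolding \<phi>_def by (rule someI_ex)
    moreover have "infdist x (F n) \<le> r" using infdist_le2[OF y(1)] y(2) by (simp add: dist_commute)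
    ultimately show "\<phi> n x \<in> F n \<and> dist (\<phi> n x) x \<le> r" by (simp add: dist_commute)
  qed
  have "\<forall>\<^sub>F n in sequentially. \<phi> n \<in> S \<rightarrow> F n"
    using ev[OF zero_less_one] by eventually_elim (use \<phi> in blast)
  moreover have "(\<lambda>n. \<phi> n x) \<longlonglongrightarrow> x" if x: "x \<in> S" for x
    unfolding tendsto_iff
  proof (intro allI impI)
    fix e :: real assume "e > 0"
    then have "\<forall>\<^sub>F n in sequentially. finite (F n) \<and> card (F n) = card S \<and> (\<forall>x\<in>S. \<exists>y\<in>F n. dist y x \<le> e / 2)"
      by (intro ev) simp
    then show "\<forall>\<^sub>F n in sequentially. dist (\<phi> n x) x < e"
    proof eventually_elim
      case (elim n)
      then show ?case using \<phi>[OF elim] x \<open>e > 0\<close> by fastforce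
    qed
  qed
  moreover have "\<forall>\<^sub>F n in sequentially. finite (F n) \<and> card (F n) = card S"
    using ev[OF zero_less_one] by eventually_elim auto
  ultimately show ?thesis unfolding set_converges_def using fin by blast
qed

text \<open>Zeros of the gradient near a nondegenerate critical point are the fixed points of this
  simplified Newton map, whose derivative \<open>1 - B ** hessian g s = B ** (A - hessian g s)\<close> is small.\<close>

lemma newton_map_contraction:
  fixes A B :: "real ^ 'd ^ 'd"
  assumes g: "g \<in> C2_functions" and sub: "cball x r \<subseteq> unit_cube" and BA: "B ** A = mat 1"
    and small: "\<And>s. s \<in> cball x r \<Longrightarrow> norm B * norm (hessian g s - A) \<le> 1 / 2"
    and s: "s \<in> cball x r" and t: "t \<in> cball x r"
  shows "norm ((s - B *v gradient g s) - (t - B *v gradient g t)) \<le> 1 / 2 * norm (s - t)"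
proof (rule differentiable_bound[OF convex_cball _ _ s t])
  fix s assume s: "s \<in> cball x r"
  have "(gradient g has_derivative (\<lambda>v. hessian g s *v v)) (at s within cball x r)"
    using s sub by (intro has_derivative_subset[OF gradient_has_derivative_hessian[OF g]]) auto
  then show "((\<lambda>s. s - B *v gradient g s) has_derivative (\<lambda>v. v - B *v (hessian g s *v v))) (at s within cball x r)"
    by (intro has_derivative_diff has_derivative_ident
        bounded_linear.has_derivative[OF matrix_vector_mul_bounded_linear])
  show "onorm (\<lambda>v. v - B *v (hessian g s *v v)) \<le> 1 / 2"
  proof (rule onorm_bound)
    fix v
    have "v = B *v (A *v v)" by (simp add: matrix_vector_mul_assoc BA)
    then have "v - B *v (hessian g s *v v) = - (B *v ((hessian g s - A) *v v))"
      by (simp add: matrix_vector_mult_diff_rdistrib matrix_vector_mult_diff_distrib)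
    then have "norm (v - B *v (hessian g s *v v)) \<le> norm B * norm ((hessian g s - A) *v v)"
      by (simp add: norm_matrix_vector_mult_le)
    also have "\<dots> \<le> norm B * (norm (hessian g s - A) * norm v)"
      by (intro mult_left_mono norm_matrix_vector_mult_le) simp
    also have "\<dots> \<le> 1 / 2 * norm v"
      using mult_right_mono[OF small[OF s], of "norm v"] by (simp add: mult.assoc)
    finally show "norm (v - B *v (hessian g s *v v)) \<le> 1 / 2 * norm v" .
  qed simp
qed

lemma C2_convergence_uniform:
  fixes f :: "real ^ 'd \<Rightarrow> real"
  assumes f: "f \<in> C2_functions" and gs: "\<And>n. gs n \<in> C2_functions"
    and conv: "(\<lambda>n. C2_norm (\<lambda>t. gs n t - f t)) \<longlonglongrightarrow> 0" and e: "e > 0"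
  shows "\<forall>\<^sub>F n in sequentially. \<forall>t\<in>unit_cube.
    norm (gradient (gs n) t - gradient f t) < e \<and> norm (hessian (gs n) t - hessian f t) < e"
proof -
  have "(\<lambda>n. real CARD('d) ^ 2 * C2_norm (\<lambda>t. gs n t - f t)) \<longlonglongrightarrow> 0"
    by (rule tendsto_mult_right_zero[OF conv])
  from order_tendstoD(2)[OF this e] show ?thesis
    by eventually_elim (use norm_gradient_diff_le[OF f gs] norm_hessian_diff_le[OF f gs] in \<open>fastforce intro: le_less_trans\<close>)
qed

lemma diff_add_diff_cancel: "(a - b) + (b - c) = a - (c :: 'a :: ab_group_add)"
  by simp

text \<open>One radius \<open>r0\<close>, fixed before \<open>n\<close>, serves uniqueness and the
  index; existence is stated in arbitrarily small balls because this makes the new critical points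
  converge to \<open>x\<close>. The contraction property gives injectivity of the gradient, Banach's
  theorem a zero.\<close>

lemma nondegenerate_critical_point_persists:
  fixes f :: "real ^ 'd \<Rightarrow> real"
  assumes f: "f \<in> C2_functions" and gs: "\<And>n. gs n \<in> C2_functions"
    and conv: "(\<lambda>n. C2_norm (\<lambda>t. gs n t - f t)) \<longlonglongrightarrow> 0"
    and x: "x \<in> box 0 1" "gradient f x = 0" "det (hessian f x) \<noteq> 0"
  obtains r0 where "r0 > 0" "cball x r0 \<subseteq> unit_cube"
    "\<forall>\<^sub>F n in sequentially. inj_on (gradient (gs n)) (cball x r0) \<and>
       (\<forall>t\<in>cball x r0. matrix_index (hessian (gs n) t) = matrix_index (hessian f x))"
    "\<And>r. 0 < r \<Longrightarrow> r \<le> r0 \<Longrightarrow> \<forall>\<^sub>F n in sequentially. \<exists>t\<in>cball x r. gradient (gs n) t = 0"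
proof -
  define A where "A = hessian f x"
  have xW: "x \<in> unit_cube" using x(1) box_subset_cbox by blast
  obtain B where B: "A ** B = mat 1" "B ** A = mat 1"
    using x(3) unfolding A_def invertible_det_nz[symmetric] invertible_def by blast
  \<comment> \<open>Injectivity of \<open>B\<close> turns fixed points of the Newton map into
    critical points.\<close>
  have B0: "v = 0" if "B *v v = 0" for v
    using that B(1) by (metis matrix_vector_mul_assoc matrix_vector_mul_lid matrix_vector_mult_0_right)
  obtain e0 where e0: "e0 > 0"
    "\<And>M. transpose M = M \<Longrightarrow> norm (M - A) < e0 \<Longrightarrow> matrix_index M = matrix_index A"
    using matrix_index_locally_constant[OF transpose_hessian[OF f xW] x(3)] unfolding A_def by blast
  \<comment> \<open>\<open>e0\<close> fixes the index, and the other bound yields the contraction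
    factor 1/2; the \<open>+ 1\<close> makes the divisor visibly positive. Half of \<open>e\<close>
    is spent on the variation of the Hessian of \<open>f\<close> near \<open>x\<close>, half on its
    distance to that of \<open>gs n\<close>.\<close>
  define e where "e = min e0 (1 / (2 * (norm B + 1)))"
  have nB: "norm B + 1 > 0" using norm_ge_zero[of B] by linarith
  have e: "e > 0" "e \<le> e0" using e0(1) nB by (auto simp: e_def)
  have "(norm B + 1) * e \<le> (norm B + 1) * (1 / (2 * (norm B + 1)))"
    using nB by (intro mult_left_mono) (auto simp: e_def)
  also have "\<dots> = 1 / 2" using nB by (simp add: field_simps)
  finally have Be: "(norm B + 1) * e \<le> 1 / 2" .
  obtain d where d: "d > 0" "\<And>t. t \<in> unit_cube \<Longrightarrow> dist t x < d \<Longrightarrow> dist (hessian f t) A < e / 2"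
    using continuous_on_hessian[OF f] xW half_gt_zero[OF e(1)] unfolding continuous_on_iff A_def by meson
  obtain r1 where r1: "r1 > 0" "cball x r1 \<subseteq> box 0 1"
    using x(1) open_contains_cball[of "box 0 (1 :: real ^ 'd)"] open_box by blast
  define r0 where "r0 = min r1 (d / 2)"
  have r0: "r0 > 0" "r0 < d" "r0 \<le> r1" using r1(1) d(1) by (auto simp: r0_def)
  have sub: "cball x r0 \<subseteq> unit_cube"
    using r1(2) subset_cball[OF r0(3)] box_subset_cbox by blast
  have close: "\<forall>\<^sub>F n in sequentially. \<forall>t\<in>cball x r0. norm (hessian (gs n) t - A) < e"
    using C2_convergence_uniform[OF f gs conv half_gt_zero[OF e(1)]]
  proof eventually_elim
    case (elim n)
    show ?case
    proof
      fix t assume t: "t \<in> cball x r0"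
      have "norm (hessian f t - A) < e / 2"
        using d(2)[of t] t sub r0 by (auto simp: dist_norm norm_minus_commute subset_iff)
      moreover have "norm (hessian (gs n) t - hessian f t) < e / 2" using elim t sub by blast
      ultimately show "norm (hessian (gs n) t - A) < e"
        using norm_triangle_ineq[of "hessian (gs n) t - hessian f t" "hessian f t - A"] by simp
    qed
  qed
  have contr: "norm ((s - B *v gradient (gs n) s) - (t - B *v gradient (gs n) t)) \<le> 1 / 2 * norm (s - t)"
    if n: "\<forall>t\<in>cball x r0. norm (hessian (gs n) t - A) < e" and "s \<in> cball x r0" "t \<in> cball x r0" for n s t
  proof (rule newton_map_contraction[OF gs sub B(2) _ that(2,3)])
    fix s assume "s \<in> cball x r0"
    then have "norm B * norm (hessian (gs n) s - A) \<le> (norm B + 1) * e"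
      using n by (intro mult_mono) (auto intro: less_imp_le)
    with Be show "norm B * norm (hessian (gs n) s - A) \<le> 1 / 2" by simp
  qed
  show thesis
  proof (rule that[OF r0(1) sub])
    show "\<forall>\<^sub>F n in sequentially. inj_on (gradient (gs n)) (cball x r0) \<and>
       (\<forall>t\<in>cball x r0. matrix_index (hessian (gs n) t) = matrix_index (hessian f x))"
      using close
    proof eventually_elim
      case (elim n)
      have "s = t" if "s \<in> cball x r0" "t \<in> cball x r0" "gradient (gs n) s = gradient (gs n) t" for s t
        using contr[OF elim that(1,2)] that(3) by simp
      moreover have "matrix_index (hessian (gs n) t) = matrix_index A" if "t \<in> cball x r0" for t
        using that sub elim e(2) by (intro e0(2) transpose_hessian gs) fastforce+
      ultimately show ?case by (auto simp: A_def inj_on_def)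
    qed
    fix r assume r: "0 < r" "r \<le> r0"
    \<comment> \<open>A gradient this small at \<open>x\<close> makes the Newton map move the centre
      by at most \<open>r / 2\<close>; the contraction allows at most another \<open>r / 2\<close>,
      so the ball is mapped into itself.\<close>
    have "r / (2 * (norm B + 1)) > 0" using r nB by simp
    from C2_convergence_uniform[OF f gs conv this] close
    show "\<forall>\<^sub>F n in sequentially. \<exists>t\<in>cball x r. gradient (gs n) t = 0"
    proof eventually_elim
      case (elim n)
      let ?T = "\<lambda>t. t - B *v gradient (gs n) t"
      have cs: "cball x r \<subseteq> cball x r0" using r by (simp add: subset_cball)
      have "norm (gradient (gs n) x) \<le> r / (2 * (norm B + 1))" using elim(1) xW x(2) by force
      then have "norm B * norm (gradient (gs n) x) \<le> (norm B + 1) * (r / (2 * (norm B + 1)))"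
        by (intro mult_mono) auto
      also have "\<dots> = r / 2" using nB by (simp add: field_simps)
      finally have Tx: "norm (?T x - x) \<le> r / 2"
        using norm_matrix_vector_mult_le[of B "gradient (gs n) x"] by simp
      have "\<exists>!t\<in>cball x r. ?T t = t"
      proof (rule Banach_fix[OF compact_imp_complete[OF compact_cball], where c = "1 / 2"])
        show "?T ` cball x r \<subseteq> cball x r"
        proof (intro image_subsetI)
          fix t assume t: "t \<in> cball x r"
          have "norm (?T t - ?T x) \<le> 1 / 2 * norm (t - x)"
            using contr[OF elim(2)] t cs r by (metis centre_in_cball less_imp_le subsetD)
          moreover have "norm (t - x) \<le> r" using t by (simp add: dist_norm norm_minus_commute)
          moreover have "norm (?T t - x) \<le> norm (?T t - ?T x) + norm (?T x - x)"
            using norm_triangle_ineq[of "?T t - ?T x" "?T x - x"] unfolding diff_add_diff_cancel .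
          ultimately have "norm (?T t - x) \<le> r" using Tx by linarith
          then show "?T t \<in> cball x r" by (simp add: dist_norm norm_minus_commute)
        qed
        show "dist (?T s) (?T t) \<le> 1 / 2 * dist s t" if "s \<in> cball x r" "t \<in> cball x r" for s t
          unfolding dist_norm using that cs by (intro contr[OF elim(2)]) auto
      qed (use r in auto)
      then obtain t where "t \<in> cball x r" "B *v gradient (gs n) t = 0" by auto
      then show ?case using B0 by blast
    qed
  qed
qed

lemma unit_cube_0: "0 \<in> unit_cube"
  by (simp add: mem_box_cart)

lemma C2_norm_zero: "C2_norm (\<lambda>t. 0) = 0"
proof -
  have "foldr partial_deriv ks (\<lambda>t. 0) t = 0" if "t \<in> unit_cube" for ks and t :: "real ^ 'a"
    using that
  proof (induction ks arbitrary: t)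
    case (Cons k ks)
    have "partial_deriv k (foldr partial_deriv ks (\<lambda>t. 0)) t = partial_deriv k (\<lambda>t. 0) t"
      by (intro partial_deriv_cong Cons)
    also have "\<dots> = 0" by (rule partial_deriv_eqI[OF Cons.prems has_derivative_const])
    finally show ?case by simp
  qed simp
  moreover have "unit_cube \<noteq> ({} :: (real ^ 'a) set)" by (metis empty_iff unit_cube_0)
  ultimately show ?thesis by (simp add: C2_norm_def multi_deriv_def cSUP_const)
qed

section \<open>Finiteness and convergence of the critical sets\<close>

lemma MB_function_critical_point:
  assumes "MB_function f" "x \<in> unit_cube" "gradient f x = 0"
  shows "x \<in> box 0 1" "det (hessian f x) \<noteq> 0"
  using assms unfolding MB_function_def Morse_function_def frontier_cbox by auto

text \<open>An accumulation point of critical points would itself be critical, hence nondegenerate;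
  persistence for the constant sequence \<open>f\<close> says that the gradient is injective near
  it.\<close>

lemma MB_function_finite_zeros_gradient:
  fixes f :: "real ^ 'd \<Rightarrow> real"
  assumes MB: "MB_function f"
  shows "finite {t \<in> unit_cube. gradient f t = 0}" (is "finite ?Z")
proof (rule ccontr)
  assume inf: "infinite ?Z"
  have f: "f \<in> C2_functions" using MB by (simp add: MB_function_def Morse_function_def)
  obtain x where x: "x \<in> unit_cube" "x islimpt ?Z"
    using inf compact_cbox[of 0 "1 :: real ^ 'd"] unfolding compact_eq_Bolzano_Weierstrass
    by (metis (no_types, lifting) mem_Collect_eq subsetI)
  have "closed ?Z"
    by (intro continuous_closed_preimage_constant continuous_on_gradient f closed_cbox)
  then have grad: "gradient f x = 0" using x(2) closed_limpt by blast
  have conv: "(\<lambda>n::nat. C2_norm (\<lambda>t. f t - f t)) \<longlonglongrightarrow> 0" by (simp add: C2_norm_zero)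
  note crit = MB_function_critical_point[OF MB x(1) grad]
  obtain r0 where r0: "r0 > 0" "\<forall>\<^sub>F n::nat in sequentially. inj_on (gradient f) (cball x r0) \<and>
       (\<forall>t\<in>cball x r0. matrix_index (hessian f t) = matrix_index (hessian f x))"
    by (rule nondegenerate_critical_point_persists[where gs = "\<lambda>_. f", OF f f conv crit(1) grad crit(2)])
      (rule that)
  then have inj: "inj_on (gradient f) (cball x r0)" by (simp add: eventually_const_iff)
  obtain y where "y \<in> ?Z" "y \<noteq> x" "dist y x < r0"
    using x(2) r0(1) unfolding islimpt_approachable by blast
  then show False
    using inj grad r0(1) by (auto simp: inj_on_def dist_commute)
qed

text \<open>All points of \<open>Z\<close> are followed at once, whatever their index. The map
  \<open>z\<close> to the nearby critical point of \<open>gs n\<close> preserves the index, so it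
  restricts to a bijection between the sets of index \<open>l\<close>.\<close>

lemma critical_points_converge:
  fixes f :: "real ^ 'd \<Rightarrow> real"
  assumes MB: "MB_function f" and gs: "\<And>n. gs n \<in> C2_functions"
    and conv: "(\<lambda>n. C2_norm (\<lambda>t. gs n t - f t)) \<longlonglongrightarrow> 0"
  shows "set_converges (\<lambda>n. critical_points l (gs n)) (critical_points l f)"
proof -
  define Z where "Z = {t \<in> unit_cube. gradient f t = 0}"
  have f: "f \<in> C2_functions" using MB by (simp add: MB_function_def Morse_function_def)
  have fin: "finite Z" unfolding Z_def by (rule MB_function_finite_zeros_gradient[OF MB])
  have crit_sub: "critical_points l f \<subseteq> Z" by (auto simp: critical_points_def Z_def)
  have "\<forall>x\<in>Z. \<exists>r0>0. cball x r0 \<subseteq> unit_cube \<and>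
      (\<forall>\<^sub>F n in sequentially. inj_on (gradient (gs n)) (cball x r0) \<and>
        (\<forall>t\<in>cball x r0. matrix_index (hessian (gs n) t) = matrix_index (hessian f x))) \<and>
      (\<forall>r. 0 < r \<longrightarrow> r \<le> r0 \<longrightarrow> (\<forall>\<^sub>F n in sequentially. \<exists>t\<in>cball x r. gradient (gs n) t = 0))"
  proof
    fix x assume "x \<in> Z"
    then have x: "x \<in> unit_cube" "gradient f x = 0" by (auto simp: Z_def)
    show "\<exists>r0>0. cball x r0 \<subseteq> unit_cube \<and>
      (\<forall>\<^sub>F n in sequentially. inj_on (gradient (gs n)) (cball x r0) \<and>
        (\<forall>t\<in>cball x r0. matrix_index (hessian (gs n) t) = matrix_index (hessian f x))) \<and>
      (\<forall>r. 0 < r \<longrightarrow> r \<le> r0 \<longrightarrow> (\<forall>\<^sub>F n in sequentially. \<exists>t\<in>cball x r. gradient (gs n) t = 0))"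
      by (rule nondegenerate_critical_point_persists[OF f gs conv MB_function_critical_point(1)[OF MB x] x(2)
            MB_function_critical_point(2)[OF MB x]]) blast
  qed
  from bchoice[OF this] obtain R where R': "\<forall>x\<in>Z. R x > 0 \<and> cball x (R x) \<subseteq> unit_cube \<and>
      (\<forall>\<^sub>F n in sequentially. inj_on (gradient (gs n)) (cball x (R x)) \<and>
        (\<forall>t\<in>cball x (R x). matrix_index (hessian (gs n) t) = matrix_index (hessian f x))) \<and>
      (\<forall>r. 0 < r \<longrightarrow> r \<le> R x \<longrightarrow> (\<forall>\<^sub>F n in sequentially. \<exists>t\<in>cball x r. gradient (gs n) t = 0))"
    by blast
  then have R: "\<And>x. x \<in> Z \<Longrightarrow> R x > 0" "\<And>x. x \<in> Z \<Longrightarrow> cball x (R x) \<subseteq> unit_cube"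
    "\<And>x. x \<in> Z \<Longrightarrow> \<forall>\<^sub>F n in sequentially. inj_on (gradient (gs n)) (cball x (R x)) \<and>
        (\<forall>t\<in>cball x (R x). matrix_index (hessian (gs n) t) = matrix_index (hessian f x))"
    "\<And>x r. x \<in> Z \<Longrightarrow> 0 < r \<Longrightarrow> r \<le> R x \<Longrightarrow> \<forall>\<^sub>F n in sequentially. \<exists>t\<in>cball x r. gradient (gs n) t = 0"
    by blast+
  have "uniform_discrete Z" using fin uniform_discrete_finite_iff by blast
  then obtain d where d: "d > 0" "\<And>x y. x \<in> Z \<Longrightarrow> y \<in> Z \<Longrightarrow> dist x y < d \<Longrightarrow> x = y"
    unfolding uniform_discrete_def by blast
  show ?thesis
  proof (rule set_convergesI)
    show "finite (critical_points l f)" using crit_sub fin finite_subset by blast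
    fix r :: real assume r: "r > 0"
    \<comment> \<open>\<open>r\<close> is the required accuracy, \<open>d / 3\<close> makes
      \<open>z\<close> injective, and the values of \<open>R\<close> keep each small ball inside the
      ball of uniqueness. The first two entries keep the set nonempty if \<open>Z\<close> is
      empty.\<close>
    define \<rho> where "\<rho> = Min (insert r (insert (d / 3) (R ` Z)))"
    have \<rho>: "\<rho> > 0" "\<rho> \<le> r" "\<rho> \<le> d / 3" "\<And>x. x \<in> Z \<Longrightarrow> \<rho> \<le> R x"
    proof -
      show "\<rho> > 0" using fin r d(1) R(1) by (simp add: \<rho>_def)
      have "\<rho> \<le> y" if "y \<in> insert r (insert (d / 3) (R ` Z))" for y
        unfolding \<rho>_def using fin that by (intro Min_le) auto
      then show "\<rho> \<le> r" "\<rho> \<le> d / 3" "\<And>x. x \<in> Z \<Longrightarrow> \<rho> \<le> R x" by blast+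
    qed
    \<comment> \<open>On the compact set \<open>K\<close> the gradient of \<open>f\<close> stays at
      least some \<open>c > 0\<close> in norm, so the gradient of a function within \<open>c\<close>
      of it cannot vanish there.\<close>
    define K where "K = unit_cube - (\<Union>x\<in>Z. ball x \<rho>)"
    have "compact K" unfolding K_def by (intro compact_diff compact_cbox) auto
    have cont: "continuous_on K (\<lambda>t. norm (gradient f t))"
      by (intro continuous_intros continuous_on_subset[OF continuous_on_gradient[OF f]]) (auto simp: K_def)
    have pos: "norm (gradient f t) > 0" if "t \<in> K" for t
      using that \<rho>(1) by (auto simp: K_def Z_def)
    obtain c where c: "c > 0" "\<And>t. t \<in> K \<Longrightarrow> c \<le> norm (gradient f t)"
    proof (cases "K = {}")
      case False
      then obtain t0 where "t0 \<in> K" "\<forall>t\<in>K. norm (gradient f t0) \<le> norm (gradient f t)"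
        using continuous_attains_inf[OF \<open>compact K\<close> False cont] by blast
      then show thesis using that[of "norm (gradient f t0)"] pos by blast
    qed (use that[of 1] in auto)
    have "\<forall>\<^sub>F n in sequentially. \<forall>x\<in>Z. (inj_on (gradient (gs n)) (cball x (R x)) \<and>
        (\<forall>t\<in>cball x (R x). matrix_index (hessian (gs n) t) = matrix_index (hessian f x))) \<and>
        (\<exists>t\<in>cball x \<rho>. gradient (gs n) t = 0)"
    proof (intro eventually_ball_finite[OF fin] ballI)
      fix x assume x: "x \<in> Z"
      show "\<forall>\<^sub>F n in sequentially. (inj_on (gradient (gs n)) (cball x (R x)) \<and>
        (\<forall>t\<in>cball x (R x). matrix_index (hessian (gs n) t) = matrix_index (hessian f x))) \<and>
        (\<exists>t\<in>cball x \<rho>. gradient (gs n) t = 0)"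
        by (rule eventually_conj[OF R(3)[OF x] R(4)[OF x \<rho>(1) \<rho>(4)[OF x]]])
    qed
    with C2_convergence_uniform[OF f gs conv c(1)]
    show "\<forall>\<^sub>F n in sequentially. finite (critical_points l (gs n)) \<and>
        card (critical_points l (gs n)) = card (critical_points l f) \<and>
        (\<forall>x\<in>critical_points l f. \<exists>y\<in>critical_points l (gs n). dist y x \<le> r)"
    proof eventually_elim
      case (elim n)
      from elim(2) obtain z where z: "\<And>x. x \<in> Z \<Longrightarrow> z x \<in> cball x \<rho>"
        "\<And>x. x \<in> Z \<Longrightarrow> gradient (gs n) (z x) = 0" by metis
      have zR: "z x \<in> cball x (R x)" if "x \<in> Z" for x
        using z(1)[OF that] \<rho>(4)[OF that] by auto
      have inj: "inj_on z Z"
      proof (rule inj_onI)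
        fix x y assume xy: "x \<in> Z" "y \<in> Z" "z x = z y"
        have "dist x y \<le> dist x (z x) + dist y (z y)" using dist_triangle2[of x y "z x"] xy(3) by simp
        also have "\<dots> \<le> 2 * \<rho>" using z(1)[OF xy(1)] z(1)[OF xy(2)] by simp
        also have "\<dots> < d" using \<rho>(3) d(1) by simp
        finally show "x = y" using d(2) xy by blast
      qed
      have eq: "critical_points l (gs n) = z ` critical_points l f"
      proof (intro set_eqI iffI)
        fix t assume t: "t \<in> critical_points l (gs n)"
        then have tW: "t \<in> unit_cube" and tg: "gradient (gs n) t = 0" by (auto simp: critical_points_def)
        have "norm (gradient f t) < c" using elim(1) tW tg by force
        then have "t \<notin> K" using c(2) by force
        then obtain x where x: "x \<in> Z" "t \<in> ball x \<rho>" using tW by (auto simp: K_def)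
        \<comment> \<open>Existence used the radius \<open>\<rho>\<close>, uniqueness uses
          \<open>R x\<close>: both \<open>t\<close> and \<open>z x\<close> lie in that larger ball,
          where the gradient is injective.\<close>
        have tR: "t \<in> cball x (R x)" using x \<rho>(4)[OF x(1)] by auto
        have "inj_on (gradient (gs n)) (cball x (R x))" using elim(2) x(1) by blast
        from inj_onD[OF this _ tR zR[OF x(1)]] have "t = z x" using tg z(2)[OF x(1)] by simp
        moreover have "matrix_index (hessian f x) = l"
          using elim(2) x(1) tR t by (auto simp: critical_points_def)
        ultimately show "t \<in> z ` critical_points l f" using x(1) by (auto simp: critical_points_def Z_def)
      next
        fix t assume "t \<in> z ` critical_points l f"
        then obtain x where x: "t = z x" "x \<in> critical_points l f" by blast
        then have "x \<in> Z" using crit_sub by blast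
        moreover have "matrix_index (hessian (gs n) (z x)) = l"
          using elim(2) x(2) \<open>x \<in> Z\<close> zR[OF \<open>x \<in> Z\<close>] by (auto simp: critical_points_def)
        ultimately show "t \<in> critical_points l (gs n)"
          using zR z(2) subsetD[OF R(2) zR] x(1) by (simp add: critical_points_def)
      qed
      have "card (critical_points l (gs n)) = card (critical_points l f)"
        unfolding eq by (rule card_image[OF inj_on_subset[OF inj crit_sub]])
      moreover have "dist (z x) x \<le> r" if "x \<in> critical_points l f" for x
        using z(1)[of x] that crit_sub \<rho>(2) by (auto simp: dist_commute)
      ultimately show ?case
        unfolding eq using crit_sub fin by (auto intro: finite_subset)
    qed
  qed
qed

section \<open>Measurability\<close>

text \<open>The union over \<open>t\<close> is uncountable. By compactness the distance of
  \<open>G \<omega> t\<close> to \<open>C\<close> attains its minimum, so \<open>C\<close> is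
  reached exactly if this distance gets arbitrarily small on a countable dense subset of
  \<open>K\<close>.\<close>

lemma sets_Bex_closed:
  fixes G :: "'a \<Rightarrow> 'b::{metric_space, second_countable_topology} \<Rightarrow> 'c::{metric_space, second_countable_topology}"
  assumes K: "compact K" and C: "closed C"
    and meas: "\<And>t. t \<in> K \<Longrightarrow> (\<lambda>\<omega>. G \<omega> t) \<in> borel_measurable M"
    and cont: "\<And>\<omega>. \<omega> \<in> space M \<Longrightarrow> continuous_on K (G \<omega>)"
  shows "{\<omega> \<in> space M. \<exists>t\<in>K. G \<omega> t \<in> C} \<in> sets M"
\<comment> \<open>\<open>infdist\<close> to the empty set is 0 by convention, and an empty
  \<open>K\<close> has no minimiser.\<close>
proof (cases "K = {} \<or> C = {}")
  case True
  then have "{\<omega> \<in> space M. \<exists>t\<in>K. G \<omega> t \<in> C} = {}" by blast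
  then show ?thesis by (simp only: sets.empty_sets)
next
  case False
  obtain D where D: "countable D" "D \<subseteq> K" "K \<subseteq> closure D" by (rule separable)
  let ?g = "\<lambda>\<omega> t. infdist (G \<omega> t) C"
  have "(\<exists>t\<in>K. G \<omega> t \<in> C) \<longleftrightarrow> (\<forall>n. \<exists>t\<in>D. ?g \<omega> t < 1 / real (Suc n))" if \<omega>: "\<omega> \<in> space M" for \<omega>
  proof
    have cg: "continuous_on K (?g \<omega>)" by (intro continuous_on_infdist cont \<omega>)
    assume "\<exists>t\<in>K. G \<omega> t \<in> C"
    then obtain t where t: "t \<in> K" "?g \<omega> t = 0" by auto
    show "\<forall>n. \<exists>t\<in>D. ?g \<omega> t < 1 / real (Suc n)"
    proof
      fix n
      obtain d where d: "d > 0" "\<And>s. s \<in> K \<Longrightarrow> dist s t < d \<Longrightarrow> dist (?g \<omega> s) (?g \<omega> t) < 1 / real (Suc n)"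
        using cg t(1) unfolding continuous_on_iff by (metis of_nat_0_less_iff zero_less_Suc zero_less_divide_1_iff)
      obtain s where "s \<in> D" "dist s t < d"
        using t(1) D(3) d(1) closure_approachable by blast
      then have "?g \<omega> s < 1 / real (Suc n)" using d(2)[of s] D(2) t(2) by (auto simp: dist_real_def)
      then show "\<exists>t\<in>D. ?g \<omega> t < 1 / real (Suc n)" using \<open>s \<in> D\<close> by blast
    qed
  next
    have cg: "continuous_on K (?g \<omega>)" by (intro continuous_on_infdist cont \<omega>)
    assume small: "\<forall>n. \<exists>t\<in>D. ?g \<omega> t < 1 / real (Suc n)"
    obtain t where t: "t \<in> K" "\<And>s. s \<in> K \<Longrightarrow> ?g \<omega> t \<le> ?g \<omega> s"
      using continuous_attains_inf[OF K _ cg] False by blast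
    have "?g \<omega> t \<le> 0"
    proof (rule ccontr)
      assume "\<not> ?g \<omega> t \<le> 0"
      then obtain n where n: "inverse (real (Suc n)) < ?g \<omega> t" using reals_Archimedean[of "?g \<omega> t"] by auto
      obtain s where "s \<in> D" "?g \<omega> s < 1 / real (Suc n)" using small by blast
      moreover have "?g \<omega> t \<le> ?g \<omega> s" using t(2) \<open>s \<in> D\<close> D(2) by blast
      ultimately show False using n by (simp add: inverse_eq_divide)
    qed
    then have "?g \<omega> t = 0" using infdist_nonneg[of "G \<omega> t" C] by linarith
    then show "\<exists>t\<in>K. G \<omega> t \<in> C" using t(1) C False in_closed_iff_infdist_zero by blast
  qed
  then have "{\<omega> \<in> space M. \<exists>t\<in>K. G \<omega> t \<in> C} =
      (\<Inter>n. \<Union>t\<in>D. {\<omega> \<in> space M. ?g \<omega> t < 1 / real (Suc n)})" by auto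
  also have "\<dots> \<in> sets M"
  proof (intro sets.countable_INT image_subsetI sets.countable_UN'[OF D(1)])
    fix n t assume "t \<in> D"
    then have "(\<lambda>\<omega>. G \<omega> t) \<in> borel_measurable M" using D(2) meas by blast
    moreover have "(\<lambda>x. infdist x C) \<in> borel_measurable borel"
      by (intro borel_measurable_continuous_onI continuous_on_infdist continuous_on_id)
    ultimately have [measurable]: "(\<lambda>\<omega>. ?g \<omega> t) \<in> borel_measurable M"
      by (rule measurable_compose)
    show "{\<omega> \<in> space M. ?g \<omega> t < 1 / real (Suc n)} \<in> sets M" by measurable
  qed simp
  finally show ?thesis .
qed

text \<open>The derivative is a limit of difference quotients along a fixed sequence of steps. The
  sign \<open>\<sigma>\<close> points them into the cube from any \<open>t\<close>, and multiplying
  by it again restores direction \<open>i\<close>.\<close>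

lemma borel_measurable_partial_deriv:
  fixes F :: "'a \<Rightarrow> real ^ 'd \<Rightarrow> real"
  assumes meas: "\<And>t. t \<in> unit_cube \<Longrightarrow> (\<lambda>\<omega>. F \<omega> t) \<in> borel_measurable M"
    and diff: "\<And>\<omega>. \<omega> \<in> space M \<Longrightarrow> F \<omega> differentiable_on unit_cube" and t: "t \<in> unit_cube"
  shows "(\<lambda>\<omega>. partial_deriv i (F \<omega>) t) \<in> borel_measurable M"
proof -
  define \<sigma> :: real where "\<sigma> = (if t $ i \<le> 1 / 2 then 1 else - 1)"
  define v :: "real ^ 'd" where "v = \<sigma> *\<^sub>R axis i 1"
  \<comment> \<open>The shift by 2 makes the first step 1/2, the largest that \<open>line\<close>
    allows.\<close>
  define s where "s n = 1 / real (n + 2)" for n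
  have line: "t + a *\<^sub>R v \<in> unit_cube" if "a \<in> {0..1/2}" for a
    unfolding mem_box_cart
  proof
    fix k
    have "0 \<le> t $ k" "t $ k \<le> 1" using t by (auto simp: mem_box_cart)
    then show "(0::real ^ 'd) $ k \<le> (t + a *\<^sub>R v) $ k \<and> (t + a *\<^sub>R v) $ k \<le> (1::real ^ 'd) $ k"
      using that by (auto simp: axis_def \<sigma>_def v_def)
  qed
  have s: "s n \<in> {0..1/2}" "s n \<noteq> 0" for n by (auto simp: s_def field_simps)
  have "s \<longlonglongrightarrow> 0"
    unfolding s_def using LIMSEQ_ignore_initial_segment[OF lim_1_over_n, of 2] by simp
  then have lim: "filterlim s (at 0 within {0..1/2}) sequentially"
    unfolding filterlim_at using s by (simp add: always_eventually)
  show ?thesis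
  proof (rule borel_measurable_LIMSEQ_real)
    show "(\<lambda>\<omega>. \<sigma> * ((F \<omega> (t + s n *\<^sub>R v) - F \<omega> t) / s n)) \<in> borel_measurable M" for n
      using meas[OF line[OF s(1)]] meas[OF t] by measurable
    fix \<omega> assume "\<omega> \<in> space M"
    then have d: "F \<omega> differentiable_on unit_cube" by (rule diff)
    have "((\<lambda>u. F \<omega> (t + u *\<^sub>R v)) has_derivative (\<lambda>h. h * (gradient (F \<omega>) (t + 0 *\<^sub>R v) \<bullet> v)))
        (at 0 within {0..1/2})"
      by (rule has_derivative_along_line[OF d line]) auto
    then have "((\<lambda>u. F \<omega> (t + u *\<^sub>R v)) has_field_derivative (gradient (F \<omega>) t \<bullet> v)) (at 0 within {0..1/2})"
      by (simp add: has_field_derivative_def mult.commute[of _ "gradient (F \<omega>) t \<bullet> v"])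
    then have "((\<lambda>u. (F \<omega> (t + u *\<^sub>R v) - F \<omega> t) / u) \<longlongrightarrow> gradient (F \<omega>) t \<bullet> v) (at 0 within {0..1/2})"
      by (simp add: has_field_derivative_iff)
    from tendsto_mult_left[OF filterlim_compose[OF this lim], of \<sigma>]
    have "(\<lambda>n. \<sigma> * ((F \<omega> (t + s n *\<^sub>R v) - F \<omega> t) / s n)) \<longlonglongrightarrow> \<sigma> * (gradient (F \<omega>) t \<bullet> v)" .
    moreover have "\<sigma> * (gradient (F \<omega>) t \<bullet> v) = partial_deriv i (F \<omega>) t"
      by (auto simp: v_def gradient_def inner_axis \<sigma>_def)
    ultimately show "(\<lambda>n. \<sigma> * ((F \<omega> (t + s n *\<^sub>R v) - F \<omega> t) / s n)) \<longlonglongrightarrow> partial_deriv i (F \<omega>) t"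
      by simp
  qed
qed

lemma borel_measurable_gradient_hessian:
  fixes X :: "'a \<Rightarrow> real ^ 'd \<Rightarrow> real"
  assumes X: "C2_random_field M X" and t: "t \<in> unit_cube"
  shows "(\<lambda>\<omega>. gradient (X \<omega>) t) \<in> borel_measurable M" "(\<lambda>\<omega>. hessian (X \<omega>) t) \<in> borel_measurable M"
proof -
  have C2: "X \<omega> \<in> C2_functions" if "\<omega> \<in> space M" for \<omega> using X that by (auto simp: C2_random_field_def)
  have 1: "(\<lambda>\<omega>. partial_deriv i (X \<omega>) t) \<in> borel_measurable M" if "t \<in> unit_cube" for i t
    using X C2 that by (intro borel_measurable_partial_deriv) (auto simp: C2_random_field_def C2_functions_def)
  have 2: "(\<lambda>\<omega>. partial_deriv i (partial_deriv j (X \<omega>)) t) \<in> borel_measurable M" for i j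
    using C2 t by (intro borel_measurable_partial_deriv 1) (auto simp: C2_functions_def)
  show "(\<lambda>\<omega>. gradient (X \<omega>) t) \<in> borel_measurable M"
    using 1[OF t] by (subst borel_measurable_euclidean_space) (auto simp: Basis_vec_def inner_axis gradient_def)
  show "(\<lambda>\<omega>. hessian (X \<omega>) t) \<in> borel_measurable M"
    using 2 by (subst borel_measurable_euclidean_space) (auto simp: Basis_vec_def inner_axis hessian_def)
qed

text \<open>Index \<open>l\<close> is not a closed condition on the Hessian, but the closed cover
  splits it into countably many conditions \<open>{0} \<times> C m\<close> on gradient and Hessian,
  each handled by \<open>sets_Bex_closed\<close>.\<close>

lemma sets_critical_points_meet_compact:
  fixes X :: "'a \<Rightarrow> real ^ 'd \<Rightarrow> real"
  assumes X: "C2_random_field M X" and K: "compact K" "K \<subseteq> unit_cube"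
  shows "{\<omega> \<in> space M. critical_points l (X \<omega>) \<inter> K \<noteq> {}} \<in> sets M"
proof -
  obtain C :: "nat \<Rightarrow> (real ^ 'd ^ 'd) set" where C: "\<And>m. closed (C m)"
    "{A. transpose A = A \<and> matrix_index A = l} = (\<Union>m. C m)"
    by (rule closed_cover_symmetric_matrix_index[of l]) (rule that)
  have C2: "X \<omega> \<in> C2_functions" if "\<omega> \<in> space M" for \<omega> using X that by (auto simp: C2_random_field_def)
  have "t \<in> critical_points l (X \<omega>) \<longleftrightarrow> (\<exists>m. (gradient (X \<omega>) t, hessian (X \<omega>) t) \<in> {0} \<times> C m)"
    if "\<omega> \<in> space M" "t \<in> K" for \<omega> t
  proof -
    have "t \<in> unit_cube" using that K(2) by blast
    then have "t \<in> critical_points l (X \<omega>) \<longleftrightarrow>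
        gradient (X \<omega>) t = 0 \<and> hessian (X \<omega>) t \<in> {A. transpose A = A \<and> matrix_index A = l}"
      using transpose_hessian[OF C2[OF that(1)]] by (auto simp: critical_points_def)
    then show ?thesis unfolding C(2) by auto
  qed
  then have "{\<omega> \<in> space M. critical_points l (X \<omega>) \<inter> K \<noteq> {}} =
      (\<Union>m. {\<omega> \<in> space M. \<exists>t\<in>K. (gradient (X \<omega>) t, hessian (X \<omega>) t) \<in> {0} \<times> C m})" by blast
  also have "\<dots> \<in> sets M"
  proof (intro sets.countable_UN image_subsetI sets_Bex_closed K(1) closed_Times closed_singleton C(1))
    fix t assume "t \<in> K"
    then show "(\<lambda>\<omega>. (gradient (X \<omega>) t, hessian (X \<omega>) t)) \<in> borel_measurable M"
      using K(2) X by (intro borel_measurable_Pair borel_measurable_gradient_hessian) auto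
  next
    fix \<omega> assume "\<omega> \<in> space M"
    then show "continuous_on K (\<lambda>t. (gradient (X \<omega>) t, hessian (X \<omega>) t))"
      using K(2) C2 by (intro continuous_on_Pair continuous_on_subset[OF continuous_on_gradient]
          continuous_on_subset[OF continuous_on_hessian])
  qed
  finally show ?thesis .
qed

text \<open>The topology is given by sequences, whereas measurability needs neighbourhoods with a
  radius. If no radius worked, failures for \<open>1 / real (Suc n)\<close> would form a sequence
  outside \<open>U\<close> converging to \<open>S\<close>.\<close>

lemma openin_finite_set_topology_neighbourhood:
  fixes S :: "(real ^ 'd) set"
  assumes U: "openin finite_set_topology U" "Some S \<in> U"
  obtains r where "r > 0" "\<And>S'. finite S' \<Longrightarrow> S' \<subseteq> unit_cube \<Longrightarrow> card S' = card S \<Longrightarrow>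
    \<forall>x\<in>S. \<exists>y\<in>S'. dist y x \<le> r \<Longrightarrow> Some S' \<in> U"
proof (rule ccontr)
  assume contra: "\<not> thesis"
  have fin: "finite S" using U unfolding openin_finite_set_topology by auto
  have "\<exists>S'. finite S' \<and> S' \<subseteq> unit_cube \<and> card S' = card S \<and>
      (\<forall>x\<in>S. \<exists>y\<in>S'. dist y x \<le> 1 / real (Suc n)) \<and> Some S' \<notin> U" for n
    using contra that[of "1 / real (Suc n)"] by force
  then obtain F where F: "\<And>n. finite (F n)" "\<And>n. F n \<subseteq> unit_cube" "\<And>n. card (F n) = card S"
    "\<And>n x. x \<in> S \<Longrightarrow> \<exists>y\<in>F n. dist y x \<le> 1 / real (Suc n)" "\<And>n. Some (F n) \<notin> U" by metis
  have "set_converges F S"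
  proof (rule set_convergesI[OF fin])
    fix r :: real assume "r > 0"
    have "\<forall>\<^sub>F n in sequentially. 1 / real (Suc n) < r"
      using order_tendstoD(2)[OF LIMSEQ_Suc[OF lim_1_over_n] \<open>r > 0\<close>] .
    then show "\<forall>\<^sub>F n in sequentially. finite (F n) \<and> card (F n) = card S \<and> (\<forall>x\<in>S. \<exists>y\<in>F n. dist y x \<le> r)"
      by eventually_elim (use F in \<open>meson less_imp_le order_trans\<close>)
  qed
  then have "\<forall>\<^sub>F n in sequentially. Some (F n) \<in> U"
    using U F(1,2) unfolding openin_finite_set_topology by blast
  then show False using F(5) by (simp add: eventually_const_iff)
qed

text \<open>A finite set is located up to a small error by finitely many disjoint balls from a countable
  family, each of which it meets.\<close>

lemma sets_set_element_in_openin: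
  fixes Y :: "'a \<Rightarrow> (real ^ 'd) set"
  assumes Y: "\<And>\<omega>. \<omega> \<in> space M \<Longrightarrow> Y \<omega> \<subseteq> unit_cube"
    and meets: "\<And>K. compact K \<Longrightarrow> K \<subseteq> unit_cube \<Longrightarrow> {\<omega> \<in> space M. Y \<omega> \<inter> K \<noteq> {}} \<in> sets M"
    and U: "openin finite_set_topology U"
  shows "{\<omega> \<in> space M. set_element (Y \<omega>) \<in> U} \<in> sets M"
proof -
  obtain D :: "(real ^ 'd) set" where D: "countable D" "UNIV \<subseteq> closure D"
    using separable[of "UNIV :: (real ^ 'd) set"] by metis
  define \<K> where "\<K> = (\<lambda>(q, m). cball q (1 / real (Suc m)) \<inter> unit_cube) ` (D \<times> UNIV)"
  \<comment> \<open>Disjointness makes the number of members hit a lower bound for the number of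
    points.\<close>
  define \<A> where "\<A> = {A. finite A \<and> A \<subseteq> \<K> \<and> pairwise disjnt A}"
  define hit where "hit A = {\<omega> \<in> space M. \<forall>K\<in>A. Y \<omega> \<inter> K \<noteq> {}}" for A
  have "countable \<K>" unfolding \<K>_def using D(1) by (intro countable_image countable_SIGMA) auto
  then have "countable {A. finite A \<and> A \<subseteq> \<K>}" by (rule countable_Collect_finite_subset)
  then have countA: "countable \<A>" by (rule countable_subset[rotated]) (auto simp: \<A>_def)
  have hit: "hit A \<in> sets M" if "A \<in> \<A>" for A
  proof -
    have sub: "A \<subseteq> \<K>" using that by (simp add: \<A>_def)
    \<comment> \<open>The factor \<open>space M\<close> matters for \<open>A = {}\<close>, where the
      indexed intersection is the whole type.\<close>
    have "hit A = (\<Inter>K\<in>A. {\<omega> \<in> space M. Y \<omega> \<inter> K \<noteq> {}}) \<inter> space M" by (auto simp: hit_def)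
    moreover have "{\<omega> \<in> space M. Y \<omega> \<inter> K \<noteq> {}} \<in> sets M" if "K \<in> A" for K
    proof -
      obtain q m where "K = cball q (1 / real (Suc m)) \<inter> unit_cube"
        using subsetD[OF sub \<open>K \<in> A\<close>] unfolding \<K>_def by (auto simp del: of_nat_Suc)
      then show ?thesis by (intro meets) (simp_all add: compact_Int)
    qed
    ultimately show ?thesis
      using that by (cases "A = {}") (auto simp: \<A>_def intro!: sets.finite_INT)
  qed
  have approx: "\<exists>A\<in>\<A>. card A = card S \<and> (\<forall>K\<in>A. S \<inter> K \<noteq> {}) \<and> (\<forall>x\<in>S. \<exists>K\<in>A. K \<subseteq> cball x r)"
    if S: "finite S" "S \<subseteq> unit_cube" and r: "r > 0" for S and r :: real
  proof -
    obtain d where d: "d > 0" "\<And>x y. x \<in> S \<Longrightarrow> y \<in> S \<Longrightarrow> dist x y < d \<Longrightarrow> x = y"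
      using S(1)[folded uniform_discrete_finite_iff] unfolding uniform_discrete_def by blast
    \<comment> \<open>Points of \<open>B x\<close> are within \<open>2 / real (Suc m)\<close> of
      \<open>x\<close>, so a common point puts two centres within \<open>4 / real (Suc m)\<close>;
      the fifth brings these below \<open>r\<close> and \<open>d\<close>.\<close>
    have "min r d / 5 > 0" using r d(1) by simp
    then obtain m where "inverse (real (Suc m)) < min r d / 5" using reals_Archimedean by blast
    then have m: "2 / real (Suc m) < r" "4 / real (Suc m) < d" using r d(1)
      by (auto simp: inverse_eq_divide)
    have "\<exists>q\<in>D. dist q x < 1 / real (Suc m)" for x
      using D(2) closure_approachable[of x D] by (metis UNIV_I of_nat_0_less_iff subsetD zero_less_Suc zero_less_divide_1_iff)
    then obtain q where q: "\<And>x. q x \<in> D" "\<And>x. dist (q x) x < 1 / real (Suc m)" by metis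
    define B where "B x = cball (q x) (1 / real (Suc m)) \<inter> unit_cube" for x
    have xB: "x \<in> B x" if "x \<in> S" for x using that q(2)[of x] S(2) by (auto simp: B_def less_imp_le)
    have Bx: "dist x y \<le> 2 / real (Suc m)" if "y \<in> B x" for x y
    proof -
      have "dist x y \<le> dist (q x) x + dist (q x) y" by (metis dist_commute dist_triangle)
      also have "\<dots> \<le> 1 / real (Suc m) + 1 / real (Suc m)"
        using that less_imp_le[OF q(2)[of x]] by (intro add_mono) (auto simp: B_def)
      finally show ?thesis by simp
    qed
    have disj: "disjnt (B x) (B y)" if "x \<in> S" "y \<in> S" "x \<noteq> y" for x y
      unfolding disjnt_iff
    proof (intro allI notI)
      fix z assume "z \<in> B x \<and> z \<in> B y"
      then have "dist x y \<le> 2 / real (Suc m) + 2 / real (Suc m)"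
        using Bx[of z x] Bx[of z y] dist_triangle2[of x y z] by linarith
      also have "\<dots> < d" using m(2) by simp
      finally show False using d(2) that by blast
    qed
    have "inj_on B S" using xB disj unfolding inj_on_def disjnt_iff by metis
    then have "card (B ` S) = card S" by (rule card_image)
    moreover have "B ` S \<in> \<A>"
      using S(1) q(1) disj by (auto simp: \<A>_def \<K>_def B_def pairwise_def)
    moreover have "B x \<subseteq> cball x r" for x using Bx m(1) by force
    ultimately show ?thesis using xB by (intro bexI[of _ "B ` S"]) auto
  qed
  have card_le: "card A \<le> card T" if A: "A \<in> \<A>" and T: "finite T" "\<forall>K\<in>A. T \<inter> K \<noteq> {}" for A T
  proof -
    obtain p where p: "\<And>K. K \<in> A \<Longrightarrow> p K \<in> T \<inter> K" using bchoice[of A "\<lambda>K y. y \<in> T \<inter> K"] T(2) by blast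
    have "inj_on p A"
    proof (rule inj_onI, rule ccontr)
      fix K L assume KL: "K \<in> A" "L \<in> A" "p K = p L" "K \<noteq> L"
      then have "disjnt K L" using A by (auto simp: \<A>_def pairwise_def)
      then show False using p[OF KL(1)] p[OF KL(2)] KL(3) by (auto simp: disjnt_iff)
    qed
    then show ?thesis using p T(1) by (intro card_inj_on_le[of p]) auto
  qed
  \<comment> \<open>The event of at least \<open>k\<close> points: differences of consecutive events
    fix the cardinality, and the intersection of all is the event of an infinite set.\<close>
  define E where "E k = (\<Union>A\<in>{A \<in> \<A>. card A = k}. hit A)" for k
  have E_sets: "E k \<in> sets M" for k
    unfolding E_def by (intro sets.countable_UN' image_subsetI)
      (use hit in \<open>auto intro: countable_subset[OF _ countA]\<close>)
  have E: "E k = {\<omega> \<in> space M. infinite (Y \<omega>) \<or> k \<le> card (Y \<omega>)}" for k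
  proof (intro set_eqI iffI)
    fix \<omega> assume "\<omega> \<in> E k"
    then show "\<omega> \<in> {\<omega> \<in> space M. infinite (Y \<omega>) \<or> k \<le> card (Y \<omega>)}"
      using card_le by (auto simp: E_def hit_def)
  next
    fix \<omega> assume \<omega>: "\<omega> \<in> {\<omega> \<in> space M. infinite (Y \<omega>) \<or> k \<le> card (Y \<omega>)}"
    then obtain S where S: "finite S" "card S = k" "S \<subseteq> Y \<omega>"
      using infinite_arbitrarily_large obtain_subset_with_card_n by (metis (no_types, lifting) mem_Collect_eq)
    moreover have "Y \<omega> \<subseteq> unit_cube" using Y \<omega> by blast
    ultimately obtain A where "A \<in> \<A>" "card A = k" "\<forall>K\<in>A. S \<inter> K \<noteq> {}"
      using approx[OF S(1) _ zero_less_one] by (metis order_trans)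
    moreover from this have "\<omega> \<in> hit A" using S(3) \<omega> unfolding hit_def by blast
    ultimately show "\<omega> \<in> E k" unfolding E_def by blast
  qed
  \<comment> \<open>Families that certify membership in \<open>U\<close>: on the event of exactly
    \<open>k\<close> points, lying in \<open>U\<close> means hitting one of them. As a subset of the
    countable \<open>\<A>\<close>, \<open>good k\<close> yields a countable union of events.\<close>
  define good where "good k = {A \<in> \<A>. card A = k \<and>
    (\<forall>S. finite S \<and> S \<subseteq> unit_cube \<and> card S = k \<and> (\<forall>K\<in>A. S \<inter> K \<noteq> {}) \<longrightarrow> Some S \<in> U)}" for k
  have inU: "Some (Y \<omega>) \<in> U \<longleftrightarrow> (\<exists>A\<in>good (card (Y \<omega>)). \<omega> \<in> hit A)"
    if \<omega>: "\<omega> \<in> space M" and fin: "finite (Y \<omega>)" for \<omega>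
  proof
    assume "Some (Y \<omega>) \<in> U"
    then obtain r where r: "r > 0" "\<And>S'. finite S' \<Longrightarrow> S' \<subseteq> unit_cube \<Longrightarrow> card S' = card (Y \<omega>) \<Longrightarrow>
        \<forall>x\<in>Y \<omega>. \<exists>y\<in>S'. dist y x \<le> r \<Longrightarrow> Some S' \<in> U"
      by (rule openin_finite_set_topology_neighbourhood[OF U]) (rule that)
    obtain A where A: "A \<in> \<A>" "card A = card (Y \<omega>)" "\<forall>K\<in>A. Y \<omega> \<inter> K \<noteq> {}"
      "\<forall>x\<in>Y \<omega>. \<exists>K\<in>A. K \<subseteq> cball x r"
      using approx[OF fin Y[OF \<omega>] r(1)] by blast
    have "Some S \<in> U" if S: "finite S" "S \<subseteq> unit_cube" "card S = card (Y \<omega>)" "\<forall>K\<in>A. S \<inter> K \<noteq> {}" for S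
    proof (rule r(2)[OF S(1-3)], rule ballI)
      fix x assume "x \<in> Y \<omega>"
      then obtain K where "K \<in> A" "K \<subseteq> cball x r" using A(4) by blast
      moreover obtain y where "y \<in> S" "y \<in> K" using S(4) \<open>K \<in> A\<close> by blast
      ultimately have "y \<in> S" "dist y x \<le> r" by (auto simp: dist_commute)
      then show "\<exists>y\<in>S. dist y x \<le> r" by blast
    qed
    then have "A \<in> good (card (Y \<omega>))" using A by (auto simp: good_def)
    then show "\<exists>A\<in>good (card (Y \<omega>)). \<omega> \<in> hit A" using A(3) \<omega> by (auto simp: hit_def)
  qed (use fin Y[OF \<omega>] in \<open>auto simp: good_def hit_def\<close>)
  have "{\<omega> \<in> space M. set_element (Y \<omega>) \<in> U} =
      (if None \<in> U then (\<Inter>k. E k) else {}) \<union> (\<Union>k. (E k - E (Suc k)) \<inter> (\<Union>A\<in>good k. hit A))"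
    (is "?L = ?R1 \<union> ?R2")
  proof (intro set_eqI)
    fix \<omega>
    show "\<omega> \<in> ?L \<longleftrightarrow> \<omega> \<in> ?R1 \<union> ?R2"
    proof (cases "\<omega> \<in> space M")
      case \<omega>: True
      show ?thesis
      proof (cases "finite (Y \<omega>)")
        case True
        have card: "\<omega> \<in> E k - E (Suc k) \<longleftrightarrow> k = card (Y \<omega>)" for k using True \<omega> by (auto simp: E)
        have "\<omega> \<in> ?R2 \<longleftrightarrow> (\<exists>k. \<omega> \<in> E k - E (Suc k) \<and> (\<exists>A\<in>good k. \<omega> \<in> hit A))"
          by (simp only: UN_iff Int_iff bex_UNIV)
        then have "\<omega> \<in> ?R2 \<longleftrightarrow> (\<exists>A\<in>good (card (Y \<omega>)). \<omega> \<in> hit A)"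
          unfolding card by simp
        moreover have "\<omega> \<notin> ?R1"
        proof -
          have "\<omega> \<notin> E (Suc (card (Y \<omega>)))" using True by (simp add: E)
          then show ?thesis by auto
        qed
        ultimately show ?thesis using inU[OF \<omega> True] \<omega> True by (simp add: set_element_def)
      next
        case False
        then have "\<omega> \<in> E k" for k using \<omega> by (simp add: E)
        then show ?thesis using False \<omega> by (auto simp: set_element_def)
      qed
    next
      case False
      then have "\<omega> \<notin> E k" for k using sets.sets_into_space[OF E_sets] by blast
      then show ?thesis using False by auto
    qed
  qed
  also have "\<dots> \<in> sets M"
  proof -
    have "(\<Union>A\<in>good k. hit A) \<in> sets M" for k
      by (intro sets.countable_UN' image_subsetI)
        (use hit in \<open>auto simp: good_def intro: countable_subset[OF _ countA]\<close>)
    moreover have "(\<Inter>k. E k) \<in> sets M" using E_sets by (intro sets.countable_INT) auto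
    ultimately show ?thesis using E_sets by (intro sets.Un sets.countable_UN image_subsetI sets.Int sets.Diff) auto
  qed
  finally show ?thesis .
qed

lemma critical_points_subset_unit_cube: "critical_points l f \<subseteq> unit_cube"
  by (auto simp: critical_points_def)

lemma set_element_in_topspace:
  "S \<subseteq> unit_cube \<Longrightarrow> set_element S \<in> topspace finite_set_topology"
  by (auto simp: set_element_def)

lemma borel_measurable_critical_points_functional:
  fixes X :: "'a \<Rightarrow> real ^ 'd \<Rightarrow> real"
  assumes X: "C2_random_field M X" and h: "continuous_map finite_set_topology euclideanreal h"
  shows "(\<lambda>\<omega>. h (set_element (critical_points l (X \<omega>)))) \<in> borel_measurable M"
proof (rule borel_measurable_iff_greater[THEN iffD2], intro allI)
  fix a
  let ?U = "{s \<in> topspace finite_set_topology. h s \<in> {a<..}}"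
  have "openin finite_set_topology ?U"
    using h by (rule openin_continuous_map_preimage) (simp add: open_openin[symmetric])
  then have "{\<omega> \<in> space M. set_element (critical_points l (X \<omega>)) \<in> ?U} \<in> sets M"
    by (intro sets_set_element_in_openin critical_points_subset_unit_cube sets_critical_points_meet_compact[OF X])
  moreover have "{\<omega> \<in> space M. set_element (critical_points l (X \<omega>)) \<in> ?U} =
      {\<omega> \<in> space M. a < h (set_element (critical_points l (X \<omega>)))}"
    using set_element_in_topspace[OF critical_points_subset_unit_cube] by blast
  ultimately show "{\<omega> \<in> space M. a < h (set_element (critical_points l (X \<omega>)))} \<in> sets M" by simp
qed

section \<open>Convergence in distribution\<close>

text \<open>Testing the Hessian on unit vectors, rather than taking its determinant, makes the gap Lipschitz
  continuous in the \<open>C\<^sup>2\<close> norm; the weight \<open>infdist t (frontier unit_cube)\<close> removes the Hessian term on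
  the boundary, where the gradient alone must not vanish.\<close>

definition MB_gap_at :: "(real ^ 'd \<Rightarrow> real) \<Rightarrow> (real ^ 'd) \<times> (real ^ 'd) \<Rightarrow> real" where
  "MB_gap_at f = (\<lambda>(t, v). norm (gradient f t) + norm (hessian f t *v v) * infdist t (frontier unit_cube))"

definition MB_gap :: "(real ^ 'd \<Rightarrow> real) \<Rightarrow> real" where
  "MB_gap f = (INF p\<in>unit_cube \<times> sphere 0 1. MB_gap_at f p)"

lemma frontier_unit_cube_0: "(0 :: real ^ 'd) \<in> frontier unit_cube"
  by (simp add: frontier_cbox mem_box_cart)

lemma compact_cube_sphere: "compact (unit_cube \<times> sphere (0 :: real ^ 'd) 1)"
  by (intro compact_Times) auto

lemma cube_sphere_nonempty: "unit_cube \<times> sphere (0 :: real ^ 'd) 1 \<noteq> {}"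
proof -
  have "(0, axis undefined 1) \<in> unit_cube \<times> sphere (0 :: real ^ 'd) 1"
    using unit_cube_0 by simp
  then show ?thesis by blast
qed

lemma continuous_on_MB_gap_at:
  assumes f: "f \<in> C2_functions"
  shows "continuous_on (unit_cube \<times> sphere 0 1) (MB_gap_at f)"
proof -
  have "continuous_on (unit_cube \<times> sphere 0 1) (\<lambda>p. gradient f (fst p))"
    by (rule continuous_on_compose2[OF continuous_on_gradient[OF f]]) (auto intro: continuous_intros)
  moreover have "continuous_on (unit_cube \<times> sphere 0 1) (\<lambda>p. hessian f (fst p))"
    by (rule continuous_on_compose2[OF continuous_on_hessian[OF f]]) (auto intro: continuous_intros)
  ultimately show ?thesis
    unfolding MB_gap_at_def case_prod_beta matrix_vector_mult_def
    by (intro continuous_intros continuous_on_vec_lambda) (auto intro!: continuous_intros)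
qed

lemma MB_gap_attained:
  assumes f: "f \<in> C2_functions"
  obtains p where "p \<in> unit_cube \<times> sphere 0 1" "MB_gap f = MB_gap_at f p"
    "\<And>q. q \<in> unit_cube \<times> sphere 0 1 \<Longrightarrow> MB_gap f \<le> MB_gap_at f q"
proof -
  obtain p where p: "p \<in> unit_cube \<times> sphere 0 1"
    "\<And>q. q \<in> unit_cube \<times> sphere 0 1 \<Longrightarrow> MB_gap_at f p \<le> MB_gap_at f q"
    using continuous_attains_inf[OF compact_cube_sphere cube_sphere_nonempty continuous_on_MB_gap_at[OF f]] by blast
  then have "MB_gap f = MB_gap_at f p"
    unfolding MB_gap_def by (intro cInf_eq_minimum) auto
  with p that show thesis by simp
qed

lemma MB_gap_nonneg: "f \<in> C2_functions \<Longrightarrow> 0 \<le> MB_gap f"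
  by (rule MB_gap_attained) (auto simp: MB_gap_at_def infdist_nonneg)

text \<open>The infimum is attained, so positivity is pointwise: where the gradient vanishes, the
  second term is zero exactly at boundary points and in kernel directions of the Hessian.\<close>

lemma MB_gap_pos_iff:
  fixes f :: "real ^ 'd \<Rightarrow> real"
  assumes f: "f \<in> C2_functions"
  shows "MB_gap f > 0 \<longleftrightarrow> MB_function f"
proof
  assume pos: "MB_gap f > 0"
  have gap: "MB_gap_at f (t, v) > 0" if "t \<in> unit_cube" "norm v = 1" for t v
    using that pos by (intro less_le_trans[OF pos]) (rule MB_gap_attained[OF f], auto)
  have "det (hessian f t) \<noteq> 0" if t: "t \<in> unit_cube" "gradient f t = 0" for t
  proof
    assume "det (hessian f t) = 0"
    then obtain v where v: "v \<noteq> 0" "hessian f t *v v = 0"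
      by (metis invertible_det_nz invertible_left_inverse matrix_left_invertible_ker)
    then have "hessian f t *v ((1 / norm v) *\<^sub>R v) = 0" by (simp add: matrix_vector_mult_scaleR)
    with gap[OF t(1), of "(1 / norm v) *\<^sub>R v"] v t(2) show False by (simp add: MB_gap_at_def)
  qed
  moreover have "gradient f t \<noteq> 0" if t: "t \<in> frontier unit_cube" for t
  proof -
    have "t \<in> unit_cube" using t by (simp add: frontier_cbox)
    \<comment> \<open>The weight is zero on the frontier, so any unit vector will do.\<close>
    then show ?thesis using gap[of t "axis undefined 1"] t by (auto simp: MB_gap_at_def)
  qed
  ultimately show "MB_function f" using f by (simp add: MB_function_def Morse_function_def)
next
  assume MB: "MB_function f"
  obtain p where p: "p \<in> unit_cube \<times> sphere 0 1" "MB_gap f = MB_gap_at f p"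
    by (rule MB_gap_attained[OF f]) (rule that)
  obtain t v where tv: "p = (t, v)" "t \<in> unit_cube" "norm v = 1" using p(1) by auto
  show "MB_gap f > 0"
  proof (cases "gradient f t = 0")
    case True
    note crit = MB_function_critical_point[OF MB tv(2) True]
    have "hessian f t *v v \<noteq> 0"
      using crit(2) tv(3) by (metis invertible_det_nz invertible_left_inverse matrix_left_invertible_ker norm_zero zero_neq_one)
    moreover have "t \<notin> frontier unit_cube" using crit(1) by (simp add: frontier_cbox)
    then have "infdist t (frontier unit_cube) > 0"
      using frontier_unit_cube_0 by (intro infdist_pos_not_in_closed) auto
    ultimately show ?thesis using True by (simp add: p(2) tv(1) MB_gap_at_def)
  next
    case False
    then show ?thesis by (simp add: p(2) tv(1) MB_gap_at_def add_pos_nonneg infdist_nonneg)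
  qed
qed

text \<open>The functions \<open>MB_gap_at\<close> converge uniformly on the compact product, and
  comparing minimisers transfers this to the minima.\<close>

lemma tendsto_MB_gap:
  fixes f :: "real ^ 'd \<Rightarrow> real"
  assumes f: "f \<in> C2_functions" and gs: "\<And>n. gs n \<in> C2_functions"
    and conv: "(\<lambda>n. C2_norm (\<lambda>t. gs n t - f t)) \<longlonglongrightarrow> 0"
  shows "(\<lambda>n. MB_gap (gs n)) \<longlonglongrightarrow> MB_gap f"
  unfolding tendsto_iff
proof (intro allI impI)
  fix e :: real assume e: "e > 0"
  obtain R where R: "R > 0" "\<And>t. t \<in> unit_cube \<Longrightarrow> norm (t :: real ^ 'd) \<le> R"
    using bounded_cbox bounded_pos by metis
  have inf: "infdist t (frontier unit_cube) \<le> R" if "t \<in> unit_cube" for t :: "real ^ 'd"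
    using infdist_le[OF frontier_unit_cube_0, of t] R(2)[OF that] by simp
  \<comment> \<open>The gradient term contributes at most this amount, the Hessian term at most
    \<open>R\<close> times it, where \<open>R\<close> bounds the weight through the distance to the
    corner 0; together \<open>e / 2\<close>.\<close>
  have "e / (2 * (1 + R)) > 0" using e R(1) by simp
  from C2_convergence_uniform[OF f gs conv this]
  show "\<forall>\<^sub>F n in sequentially. dist (MB_gap (gs n)) (MB_gap f) < e"
  proof eventually_elim
    case (elim n)
    let ?d = "e / (2 * (1 + R))"
    have close: "\<bar>MB_gap_at (gs n) p - MB_gap_at f p\<bar> \<le> e / 2" if p: "p \<in> unit_cube \<times> sphere 0 1" for p
    proof -
      obtain t v where tv: "p = (t, v)" "t \<in> unit_cube" "norm v = 1" using p by auto
      let ?w = "infdist t (frontier unit_cube)"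
      have g: "norm (gradient (gs n) t - gradient f t) \<le> ?d" using elim tv(2) by (auto intro: less_imp_le)
      have "norm (hessian (gs n) t *v v - hessian f t *v v) \<le> norm (hessian (gs n) t - hessian f t) * norm v"
        using norm_matrix_vector_mult_le[of "hessian (gs n) t - hessian f t" v]
        by (simp add: matrix_vector_mult_diff_rdistrib)
      then have h: "norm (hessian (gs n) t *v v - hessian f t *v v) \<le> ?d" using elim tv by force
      have "\<bar>norm (hessian (gs n) t *v v) * ?w - norm (hessian f t *v v) * ?w\<bar> =
          \<bar>norm (hessian (gs n) t *v v) - norm (hessian f t *v v)\<bar> * ?w"
        by (simp add: left_diff_distrib[symmetric] abs_mult infdist_nonneg)
      also have "\<dots> \<le> ?d * R"
        using order_trans[OF norm_triangle_ineq3 h] inf[OF tv(2)] e R(1)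
        by (intro mult_mono) (auto simp: infdist_nonneg)
      finally have "\<bar>MB_gap_at (gs n) p - MB_gap_at f p\<bar> \<le> ?d + ?d * R"
        using order_trans[OF norm_triangle_ineq3 g] by (simp add: tv(1) MB_gap_at_def)
      also have "\<dots> = ?d * (1 + R)" by (simp only: distrib_left mult_1_right)
      also have "\<dots> = e / 2" using R(1) by (simp add: field_simps)
      finally show ?thesis .
    qed
    obtain p where p: "p \<in> unit_cube \<times> sphere 0 1" "MB_gap f = MB_gap_at f p"
      and lower_f: "\<And>q. q \<in> unit_cube \<times> sphere 0 1 \<Longrightarrow> MB_gap f \<le> MB_gap_at f q"
      by (rule MB_gap_attained[OF f]) (rule that)
    obtain q where q: "q \<in> unit_cube \<times> sphere 0 1" "MB_gap (gs n) = MB_gap_at (gs n) q"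
      and lower_g: "\<And>q. q \<in> unit_cube \<times> sphere 0 1 \<Longrightarrow> MB_gap (gs n) \<le> MB_gap_at (gs n) q"
      by (rule MB_gap_attained[OF gs]) (rule that)
    have "MB_gap (gs n) \<le> MB_gap f + e / 2" using lower_g[OF p(1)] close[OF p(1)] p(2) by linarith
    moreover have "MB_gap f \<le> MB_gap (gs n) + e / 2" using lower_f[OF q(1)] close[OF q(1)] q(2) by linarith
    ultimately show ?case using e by (simp add: dist_real_def)
  qed
qed

text \<open>Since the infimum is a minimum, a value at most \<open>a\<close> means that some pair is
  mapped into the closed half-line \<open>{..a}\<close>, as \<open>sets_Bex_closed\<close>
  requires.\<close>

lemma borel_measurable_MB_gap:
  fixes X :: "'a \<Rightarrow> real ^ 'd \<Rightarrow> real"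
  assumes X: "C2_random_field M X"
  shows "(\<lambda>\<omega>. MB_gap (X \<omega>)) \<in> borel_measurable M"
proof (rule borel_measurable_iff_le[THEN iffD2], intro allI)
  fix a
  have C2: "X \<omega> \<in> C2_functions" if "\<omega> \<in> space M" for \<omega> using X that by (auto simp: C2_random_field_def)
  have "MB_gap (X \<omega>) \<le> a \<longleftrightarrow> (\<exists>p\<in>unit_cube \<times> sphere 0 1. MB_gap_at (X \<omega>) p \<in> {..a})" if "\<omega> \<in> space M" for \<omega>
    by (rule MB_gap_attained[OF C2[OF that]]) (auto, metis mem_Sigma_iff order_trans mem_sphere_0)
  then have "{\<omega> \<in> space M. MB_gap (X \<omega>) \<le> a} =
      {\<omega> \<in> space M. \<exists>p\<in>unit_cube \<times> sphere 0 1. MB_gap_at (X \<omega>) p \<in> {..a}}" by blast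
  also have "\<dots> \<in> sets M"
  proof (rule sets_Bex_closed[OF compact_cube_sphere closed_atMost _ continuous_on_MB_gap_at[OF C2]])
    fix p :: "(real ^ 'd) \<times> (real ^ 'd)" assume "p \<in> unit_cube \<times> sphere 0 1"
    then obtain t v where tv: "p = (t, v)" "t \<in> unit_cube" by auto
    note [measurable] = borel_measurable_gradient_hessian[OF X tv(2)]
    have "(\<lambda>A :: real ^ 'd ^ 'd. A *v v) \<in> borel_measurable borel"
      unfolding matrix_vector_mult_def
      by (intro borel_measurable_continuous_onI continuous_on_vec_lambda continuous_intros)
    from measurable_compose[OF borel_measurable_gradient_hessian(2)[OF X tv(2)] this]
    have [measurable]: "(\<lambda>\<omega>. hessian (X \<omega>) t *v v) \<in> borel_measurable M" .
    show "(\<lambda>\<omega>. MB_gap_at (X \<omega>) p) \<in> borel_measurable M"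
      unfolding tv(1) MB_gap_at_def prod.case by measurable
  qed
  finally show "{\<omega> \<in> space M. MB_gap (X \<omega>) \<le> a} \<in> sets M" .
qed

section \<open>Sequential criteria for continuous functionals\<close>

lemma C2_norm_nonneg: "f \<in> C2_functions \<Longrightarrow> 0 \<le> C2_norm f"
  using abs_partial_deriv_le_C2_norm(1)[OF _ unit_cube_0] by (meson abs_ge_zero order_trans)

text \<open>Openness in \<open>C2_topology\<close> is tested by norm balls, so its failure at
  \<open>f\<close>, for the radii \<open>1 / real (Suc n)\<close>, yields a sequence converging to
  \<open>f\<close> outside the preimage.\<close>

lemma continuous_map_C2_topologyI:
  fixes F :: "(real ^ 'd \<Rightarrow> real) \<Rightarrow> real"
  assumes seq: "\<And>f gs. f \<in> C2_functions \<Longrightarrow> (\<And>n. gs n \<in> C2_functions) \<Longrightarrow>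
    (\<lambda>n. C2_norm (\<lambda>t. gs n t - f t)) \<longlonglongrightarrow> 0 \<Longrightarrow> (\<lambda>n. F (gs n)) \<longlonglongrightarrow> F f"
  shows "continuous_map C2_topology euclideanreal F"
  unfolding continuous_map
proof (intro conjI allI impI)
  fix U :: "real set" assume "openin euclidean U"
  then have U: "open U" by simp
  show "openin C2_topology {f \<in> topspace C2_topology. F f \<in> U}"
    unfolding openin_C2_topology topspace_C2_topology
  proof (intro conjI ballI)
    fix f assume f: "f \<in> {f \<in> C2_functions. F f \<in> U}"
    show "\<exists>\<epsilon>>0. \<forall>g\<in>C2_functions. C2_norm (\<lambda>t. g t - f t) < \<epsilon> \<longrightarrow> g \<in> {f \<in> C2_functions. F f \<in> U}"
    proof (rule ccontr)
      assume contra: "\<not> ?thesis"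
      have "\<exists>g\<in>C2_functions. C2_norm (\<lambda>t. g t - f t) < 1 / real (Suc n) \<and> F g \<notin> U" for n
      proof -
        have "1 / real (Suc n) > 0" by simp
        then show ?thesis using contra by blast
      qed
      then obtain gs where gs: "\<And>n. gs n \<in> C2_functions"
        "\<And>n. C2_norm (\<lambda>t. gs n t - f t) < 1 / real (Suc n)" "\<And>n. F (gs n) \<notin> U" by metis
      have "(\<lambda>n. C2_norm (\<lambda>t. gs n t - f t)) \<longlonglongrightarrow> 0"
      proof (rule tendsto_sandwich[OF _ _ tendsto_const LIMSEQ_Suc[OF lim_1_over_n]])
        show "\<forall>\<^sub>F n in sequentially. 0 \<le> C2_norm (\<lambda>t. gs n t - f t)"
          using gs(1) f by (intro always_eventually allI C2_norm_nonneg C2_functions_diff) auto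
        show "\<forall>\<^sub>F n in sequentially. C2_norm (\<lambda>t. gs n t - f t) \<le> 1 / real (Suc n)"
          using gs(2) by (intro always_eventually allI less_imp_le)
      qed
      then have "(\<lambda>n. F (gs n)) \<longlonglongrightarrow> F f" using f gs(1) by (intro seq) auto
      then have "\<forall>\<^sub>F n in sequentially. F (gs n) \<in> U" using U f by (intro topological_tendstoD) auto
      then show False using gs(3) by (simp add: eventually_const_iff)
    qed
  qed auto
qed auto

lemma tendsto_finite_set_functional:
  fixes h :: "(real ^ 'd) set option \<Rightarrow> real"
  assumes h: "continuous_map finite_set_topology euclideanreal h"
    and F: "set_converges F S" "\<And>n. F n \<subseteq> unit_cube" and S: "S \<subseteq> unit_cube"
  shows "(\<lambda>n. h (set_element (F n))) \<longlonglongrightarrow> h (set_element S)"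
proof (rule topological_tendstoI)
  fix V :: "real set" assume V: "open V" "h (set_element S) \<in> V"
  have fin: "finite S" using F(1) by (simp add: set_converges_def)
  let ?U = "{s \<in> topspace finite_set_topology. h s \<in> V}"
  have U: "openin finite_set_topology ?U"
    using h by (rule openin_continuous_map_preimage) (simp add: V(1))
  have "Some S \<in> ?U" using V(2) S fin by (auto simp: set_element_def)
  \<comment> \<open>Open sets are tested by sequences of finite sets, but finitely many
    \<open>F n\<close> may be infinite; these are replaced by \<open>S\<close>.\<close>
  define G where "G n = (if finite (F n) then F n else S)" for n
  have ev: "\<forall>\<^sub>F n in sequentially. finite (F n) \<and> card (F n) = card S"
    using F(1) by (simp add: set_converges_def)
  have "set_converges G S"
    using F(1) unfolding set_converges_def
  proof (elim conjE exE, intro conjI exI)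
    fix \<phi> assume \<phi>: "\<forall>\<^sub>F n in sequentially. \<phi> n \<in> S \<rightarrow> F n"
    show "\<forall>\<^sub>F n in sequentially. finite (G n) \<and> card (G n) = card S"
      using ev by eventually_elim (simp add: G_def)
    show "\<forall>\<^sub>F n in sequentially. \<phi> n \<in> S \<rightarrow> G n"
      using ev \<phi> by eventually_elim (simp add: G_def)
  qed
  moreover have "\<forall>n. finite (G n) \<and> G n \<subseteq> unit_cube" using fin F(2) S by (simp add: G_def)
  ultimately have "\<forall>\<^sub>F n in sequentially. Some (G n) \<in> ?U"
    using U \<open>Some S \<in> ?U\<close> unfolding openin_finite_set_topology by blast
  with ev show "\<forall>\<^sub>F n in sequentially. h (set_element (F n)) \<in> V"
    by eventually_elim (auto simp: G_def set_element_def)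
qed

text \<open>Multiplying by a continuous cutoff that vanishes off the open set of MB functions turns the
  functional into a continuous one on the whole space.\<close>

lemma continuous_map_cutoff:
  fixes h :: "(real ^ 'd) set option \<Rightarrow> real"
  assumes h: "continuous_map finite_set_topology euclideanreal h"
    and bound: "\<And>s. s \<in> topspace finite_set_topology \<Longrightarrow> \<bar>h s\<bar> \<le> b"
  shows "continuous_map C2_topology euclideanreal
    (\<lambda>f. h (set_element (critical_points l f)) * min 1 (c * MB_gap f))"
proof (rule continuous_map_C2_topologyI)
  fix f :: "real ^ 'd \<Rightarrow> real" and gs
  assume f: "f \<in> C2_functions" and gs: "\<And>n. gs n \<in> C2_functions"
    and conv: "(\<lambda>n. C2_norm (\<lambda>t. gs n t - f t)) \<longlonglongrightarrow> 0"
  let ?H = "\<lambda>f. h (set_element (critical_points l f))" and ?c = "\<lambda>f. min 1 (c * MB_gap f)"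
  have cut: "(\<lambda>n. ?c (gs n)) \<longlonglongrightarrow> ?c f"
    by (intro tendsto_intros tendsto_MB_gap f gs conv)
  show "(\<lambda>n. ?H (gs n) * ?c (gs n)) \<longlonglongrightarrow> ?H f * ?c f"
  proof (cases "MB_function f")
    case True
    show ?thesis
      by (intro tendsto_mult cut tendsto_finite_set_functional[OF h] critical_points_converge[OF True gs conv]
          critical_points_subset_unit_cube)
  next
    case False
    \<comment> \<open>Here the critical sets of \<open>gs n\<close> need not converge; the cutoff
      tends to 0, and boundedness of \<open>h\<close> is enough.\<close>
    then have "?c f = 0" using MB_gap_pos_iff[OF f] MB_gap_nonneg[OF f] by simp
    moreover have "(\<lambda>n. ?H (gs n) * ?c (gs n)) \<longlonglongrightarrow> 0"
    proof (rule Lim_null_comparison)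
      show "\<forall>\<^sub>F n in sequentially. norm (?H (gs n) * ?c (gs n)) \<le> b * \<bar>?c (gs n)\<bar>"
        using bound[OF set_element_in_topspace[OF critical_points_subset_unit_cube]]
        by (intro always_eventually allI) (simp add: abs_mult mult_right_mono)
      show "(\<lambda>n. b * \<bar>?c (gs n)\<bar>) \<longlonglongrightarrow> 0"
        using tendsto_mult_right_zero[OF tendsto_rabs_zero[OF cut[unfolded \<open>?c f = 0\<close>]]] .
    qed
    ultimately show ?thesis by simp
  qed
qed

section \<open>Removal of the cutoff\<close>

lemma cutoff_bounds:
  assumes "f \<in> C2_functions"
  shows "0 \<le> min 1 (real m * MB_gap f)" "min 1 (real m * MB_gap f) \<le> 1"
  using MB_gap_nonneg[OF assms] by auto

lemma continuous_map_MB_cutoff: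
  "continuous_map C2_topology euclideanreal (\<lambda>f. min 1 (c * MB_gap f))"
  by (intro continuous_map_C2_topologyI tendsto_intros tendsto_MB_gap)

text \<open>The bound involves only the expectation of the cutoff, a bounded continuous functional;
  hence the bound for \<open>Xs n\<close> itself converges as \<open>n\<close> grows.\<close>

lemma (in prob_space) expectation_cutoff_error:
  fixes X :: "'a \<Rightarrow> real ^ 'd \<Rightarrow> real" and l m :: nat
  assumes X: "C2_random_field M X" and h: "continuous_map finite_set_topology euclideanreal h"
    and bound: "\<And>s. s \<in> topspace finite_set_topology \<Longrightarrow> \<bar>h s\<bar> \<le> b"
  defines "H \<equiv> \<lambda>f. h (set_element (critical_points l f))" and "c \<equiv> \<lambda>f. min 1 (real m * MB_gap f)"
  shows "\<bar>expectation (\<lambda>\<omega>. H (X \<omega>)) - expectation (\<lambda>\<omega>. H (X \<omega>) * c (X \<omega>))\<bar>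
    \<le> b * (1 - expectation (\<lambda>\<omega>. c (X \<omega>)))"
proof -
  have C2: "X \<omega> \<in> C2_functions" if "\<omega> \<in> space M" for \<omega> using X that by (auto simp: C2_random_field_def)
  have Hb: "\<bar>H f\<bar> \<le> b" for f
    unfolding H_def by (intro bound set_element_in_topspace critical_points_subset_unit_cube)
  have c: "0 \<le> c (X \<omega>)" "c (X \<omega>) \<le> 1" if "\<omega> \<in> space M" for \<omega>
    using cutoff_bounds[OF C2[OF that]] by (simp_all add: c_def)
  have [measurable]: "(\<lambda>\<omega>. H (X \<omega>)) \<in> borel_measurable M"
    unfolding H_def by (rule borel_measurable_critical_points_functional[OF X h])
  have [measurable]: "(\<lambda>\<omega>. MB_gap (X \<omega>)) \<in> borel_measurable M" by (rule borel_measurable_MB_gap[OF X])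
  have [measurable]: "(\<lambda>\<omega>. c (X \<omega>)) \<in> borel_measurable M" unfolding c_def by measurable
  have iH: "integrable M (\<lambda>\<omega>. H (X \<omega>))"
    using Hb by (intro integrable_const_bound[of _ b]) auto
  have ic: "integrable M (\<lambda>\<omega>. c (X \<omega>))"
    using c by (intro integrable_const_bound[of _ 1]) auto
  have b0: "b \<ge> 0" using Hb[of undefined] by linarith
  have iHc: "integrable M (\<lambda>\<omega>. H (X \<omega>) * c (X \<omega>))"
  proof (rule integrable_const_bound[of _ b])
    show "AE \<omega> in M. norm (H (X \<omega>) * c (X \<omega>)) \<le> b"
    proof (rule AE_I2)
      fix \<omega> assume "\<omega> \<in> space M"
      then have "\<bar>H (X \<omega>)\<bar> * \<bar>c (X \<omega>)\<bar> \<le> b * 1" using Hb c b0 by (intro mult_mono) auto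
      then show "norm (H (X \<omega>) * c (X \<omega>)) \<le> b" by (simp add: abs_mult)
    qed
  qed simp
  have "expectation (\<lambda>\<omega>. H (X \<omega>)) - expectation (\<lambda>\<omega>. H (X \<omega>) * c (X \<omega>)) =
      expectation (\<lambda>\<omega>. H (X \<omega>) - H (X \<omega>) * c (X \<omega>))"
    by (rule Bochner_Integration.integral_diff[OF iH iHc, symmetric])
  also have "\<bar>\<dots>\<bar> \<le> expectation (\<lambda>\<omega>. \<bar>H (X \<omega>) - H (X \<omega>) * c (X \<omega>)\<bar>)"
    by (rule integral_abs_bound)
  also have "\<dots> \<le> expectation (\<lambda>\<omega>. b * (1 - c (X \<omega>)))"
  proof (rule integral_mono)
    fix \<omega> assume \<omega>: "\<omega> \<in> space M"
    have "\<bar>H (X \<omega>) - H (X \<omega>) * c (X \<omega>)\<bar> = \<bar>H (X \<omega>)\<bar> * (1 - c (X \<omega>))"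
    proof -
      have "H (X \<omega>) - H (X \<omega>) * c (X \<omega>) = H (X \<omega>) * (1 - c (X \<omega>))" by (simp add: algebra_simps)
      then show ?thesis using c[OF \<omega>] by (simp add: abs_mult)
    qed
    also have "\<dots> \<le> b * (1 - c (X \<omega>))" using Hb c[OF \<omega>] by (intro mult_right_mono) auto
    finally show "\<bar>H (X \<omega>) - H (X \<omega>) * c (X \<omega>)\<bar> \<le> b * (1 - c (X \<omega>))" .
  qed (use iH iHc ic in auto)
  also have "\<dots> = b * (1 - expectation (\<lambda>\<omega>. c (X \<omega>)))"
    using ic by (simp add: prob_space)
  finally show ?thesis .
qed

lemma (in prob_space) expectation_cutoff_tendsto:
  fixes X :: "'a \<Rightarrow> real ^ 'd \<Rightarrow> real"
  assumes X: "C2_random_field M X" and MB: "AE \<omega> in M. MB_function (X \<omega>)"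
  shows "(\<lambda>m. expectation (\<lambda>\<omega>. min 1 (real m * MB_gap (X \<omega>)))) \<longlonglongrightarrow> 1"
proof -
  have C2: "X \<omega> \<in> C2_functions" if "\<omega> \<in> space M" for \<omega> using X that by (auto simp: C2_random_field_def)
  have [measurable]: "(\<lambda>\<omega>. MB_gap (X \<omega>)) \<in> borel_measurable M" by (rule borel_measurable_MB_gap[OF X])
  have "(\<lambda>m. expectation (\<lambda>\<omega>. min 1 (real m * MB_gap (X \<omega>)))) \<longlonglongrightarrow> expectation (\<lambda>\<omega>. 1)"
  proof (rule integral_dominated_convergence[where w = "\<lambda>_. 1"])
    show "AE \<omega> in M. (\<lambda>m. min 1 (real m * MB_gap (X \<omega>))) \<longlonglongrightarrow> 1"
      using MB AE_space
    proof eventually_elim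
      case (elim \<omega>)
      then have pos: "MB_gap (X \<omega>) > 0" using MB_gap_pos_iff[OF C2] by blast
      have "\<forall>\<^sub>F m in sequentially. 1 / MB_gap (X \<omega>) \<le> real m"
        using filterlim_real_sequentially by (simp add: filterlim_at_top)
      then have "\<forall>\<^sub>F m in sequentially. min 1 (real m * MB_gap (X \<omega>)) = 1"
        by eventually_elim (use pos in \<open>simp add: divide_le_eq min_def\<close>)
      then show ?case by (rule tendsto_eventually)
    qed
    show "AE \<omega> in M. norm (min 1 (real m * MB_gap (X \<omega>))) \<le> 1" for m
      using cutoff_bounds[OF C2, of _ m] by (intro AE_I2) auto
  qed auto
  then show ?thesis by (simp add: prob_space)
qed

theorem theorem5:
  fixes M :: "'a measure" and Ms :: "nat \<Rightarrow> 'a measure"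
    and X :: "'a \<Rightarrow> real ^ 'd \<Rightarrow> real" and Xs :: "nat \<Rightarrow> 'a \<Rightarrow> real ^ 'd \<Rightarrow> real"
  assumes "prob_space M" and "\<And>n. prob_space (Ms n)"
    and "C2_random_field M X" and "\<And>n. C2_random_field (Ms n) (Xs n)"
    and "AE \<omega> in M. MB_function (X \<omega>)"
  shows "((\<forall>n. Ms n = M) \<and> (AE \<omega> in M. (\<lambda>n. C2_norm (\<lambda>t. Xs n \<omega> t - X \<omega> t)) \<longlonglongrightarrow> 0) \<longrightarrow>
           (\<forall>l\<le>CARD('d). AE \<omega> in M.
              set_converges (\<lambda>n. critical_points l (Xs n \<omega>)) (critical_points l (X \<omega>)))) \<and>
         (converges_in_distribution C2_topology Ms Xs M X \<longrightarrow>
           (\<forall>l\<le>CARD('d). converges_in_distribution finite_set_topology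
              Ms (\<lambda>n \<omega>. set_element (critical_points l (Xs n \<omega>)))
              M (\<lambda>\<omega>. set_element (critical_points l (X \<omega>)))))"
proof (intro conjI impI)
  have C2: "\<And>\<omega>. \<omega> \<in> space M \<Longrightarrow> X \<omega> \<in> C2_functions" "\<And>n \<omega>. \<omega> \<in> space (Ms n) \<Longrightarrow> Xs n \<omega> \<in> C2_functions"
    using assms(3,4) by (auto simp: C2_random_field_def)
  {
    assume a: "(\<forall>n. Ms n = M) \<and> (AE \<omega> in M. (\<lambda>n. C2_norm (\<lambda>t. Xs n \<omega> t - X \<omega> t)) \<longlonglongrightarrow> 0)"
    then have conv: "AE \<omega> in M. (\<lambda>n. C2_norm (\<lambda>t. Xs n \<omega> t - X \<omega> t)) \<longlonglongrightarrow> 0" by blast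
    show "\<forall>l\<le>CARD('d). AE \<omega> in M.
        set_converges (\<lambda>n. critical_points l (Xs n \<omega>)) (critical_points l (X \<omega>))"
    proof (intro allI impI)
      fix l
      show "AE \<omega> in M. set_converges (\<lambda>n. critical_points l (Xs n \<omega>)) (critical_points l (X \<omega>))"
        using conv assms(5) AE_space
      proof eventually_elim
        case (elim \<omega>)
        then show ?case using a C2(2)[of \<omega>] by (intro critical_points_converge) auto
      qed
    qed
  next
    assume conv: "converges_in_distribution C2_topology Ms Xs M X"
    interpret prob_space M by (rule assms(1))
    show "\<forall>l\<le>CARD('d). converges_in_distribution finite_set_topology
        Ms (\<lambda>n \<omega>. set_element (critical_points l (Xs n \<omega>))) M (\<lambda>\<omega>. set_element (critical_points l (X \<omega>)))"
      unfolding converges_in_distribution_def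
    proof (intro allI impI, elim conjE)
      fix l and h :: "(real ^ 'd) set option \<Rightarrow> real"
      assume h: "continuous_map finite_set_topology euclideanreal h"
        and "bounded (h ` topspace finite_set_topology)"
      then obtain b where b: "b > 0" and bound: "\<And>s. s \<in> topspace finite_set_topology \<Longrightarrow> \<bar>h s\<bar> \<le> b"
        unfolding bounded_pos by (auto simp del: topspace_finite_set_topology)
      define H where "H f = h (set_element (critical_points l f))" for f :: "real ^ 'd \<Rightarrow> real"
      define c where "c m f = min 1 (real m * MB_gap f)" for m and f :: "real ^ 'd \<Rightarrow> real"
      have Hb: "\<bar>H f\<bar> \<le> b" for f
        unfolding H_def by (intro bound set_element_in_topspace critical_points_subset_unit_cube)
      have err: "\<bar>(\<integral>\<omega>. H (X \<omega>) \<partial>M) - (\<integral>\<omega>. H (X \<omega>) * c m (X \<omega>) \<partial>M)\<bar> \<le> b * (1 - (\<integral>\<omega>. c m (X \<omega>) \<partial>M))" for m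
        unfolding H_def c_def by (rule expectation_cutoff_error[OF assms(3) h bound])
      have errs: "\<bar>(\<integral>\<omega>. H (Xs n \<omega>) \<partial>Ms n) - (\<integral>\<omega>. H (Xs n \<omega>) * c m (Xs n \<omega>) \<partial>Ms n)\<bar>
          \<le> b * (1 - (\<integral>\<omega>. c m (Xs n \<omega>) \<partial>Ms n))" for n m
        unfolding H_def c_def by (rule prob_space.expectation_cutoff_error[OF assms(2) assms(4) h bound])
      have lim_c: "(\<lambda>n. \<integral>\<omega>. c m (Xs n \<omega>) \<partial>Ms n) \<longlonglongrightarrow> (\<integral>\<omega>. c m (X \<omega>) \<partial>M)" for m
      proof -
        have "bounded (c m ` topspace C2_topology)"
          unfolding bounded_iff
        proof (intro exI ballI, elim imageE)
          fix x f assume "x = c m f" "f \<in> topspace C2_topology"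
          then show "norm x \<le> 1" using cutoff_bounds[of f m] unfolding c_def by (simp add: abs_le_iff)
        qed
        with conv continuous_map_MB_cutoff[of "real m"] show ?thesis
          unfolding converges_in_distribution_def c_def by blast
      qed
      have lim_Hc: "(\<lambda>n. \<integral>\<omega>. H (Xs n \<omega>) * c m (Xs n \<omega>) \<partial>Ms n) \<longlonglongrightarrow> (\<integral>\<omega>. H (X \<omega>) * c m (X \<omega>) \<partial>M)" for m
      proof -
        have "\<bar>H f * c m f\<bar> \<le> b" if "f \<in> C2_functions" for f
        proof -
          have "\<bar>H f\<bar> * \<bar>c m f\<bar> \<le> b * 1"
            using Hb cutoff_bounds[OF that, of m] b by (intro mult_mono) (auto simp: c_def)
          then show ?thesis by (simp add: abs_mult)
        qed
        then have "bounded ((\<lambda>f. H f * c m f) ` topspace C2_topology)"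
          by (auto simp: bounded_iff intro!: exI[of _ b])
        with conv continuous_map_cutoff[OF h bound, of l "real m"] show ?thesis
          unfolding converges_in_distribution_def c_def H_def by blast
      qed
      have "(\<lambda>n. \<integral>\<omega>. H (Xs n \<omega>) \<partial>Ms n) \<longlonglongrightarrow> (\<integral>\<omega>. H (X \<omega>) \<partial>M)"
        unfolding tendsto_iff
      proof (intro allI impI)
        fix e :: real assume e: "e > 0"
        have "(\<lambda>m. b * (1 - (\<integral>\<omega>. c m (X \<omega>) \<partial>M))) \<longlonglongrightarrow> b * (1 - 1)"
          unfolding c_def by (intro tendsto_intros expectation_cutoff_tendsto assms)
        then have "\<forall>\<^sub>F m in sequentially. b * (1 - (\<integral>\<omega>. c m (X \<omega>) \<partial>M)) < e / 3"
          using e by (intro order_tendstoD(2)) auto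
        \<comment> \<open>The cutoff level is chosen from the limit field alone; \<open>ev1\<close>
          then carries the bound over to all large \<open>n\<close>, and three errors below
          \<open>e / 3\<close> remain.\<close>
        then obtain m where m: "b * (1 - (\<integral>\<omega>. c m (X \<omega>) \<partial>M)) < e / 3"
          by (auto simp: eventually_sequentially)
        have "(\<lambda>n. b * (1 - (\<integral>\<omega>. c m (Xs n \<omega>) \<partial>Ms n))) \<longlonglongrightarrow> b * (1 - (\<integral>\<omega>. c m (X \<omega>) \<partial>M))"
          by (intro tendsto_intros lim_c)
        from order_tendstoD(2)[OF this m]
        have ev1: "\<forall>\<^sub>F n in sequentially. b * (1 - (\<integral>\<omega>. c m (Xs n \<omega>) \<partial>Ms n)) < e / 3" .
        have ev2: "\<forall>\<^sub>F n in sequentially.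
            dist (\<integral>\<omega>. H (Xs n \<omega>) * c m (Xs n \<omega>) \<partial>Ms n) (\<integral>\<omega>. H (X \<omega>) * c m (X \<omega>) \<partial>M) < e / 3"
          using lim_Hc e by (intro tendstoD) auto
        from ev1 ev2 show "\<forall>\<^sub>F n in sequentially. dist (\<integral>\<omega>. H (Xs n \<omega>) \<partial>Ms n) (\<integral>\<omega>. H (X \<omega>) \<partial>M) < e"
        proof eventually_elim
          case (elim n)
          then show ?case using errs[of n m] err[of m] m unfolding dist_real_def by linarith
        qed
      qed
      then show "(\<lambda>n. \<integral>\<omega>. h (set_element (critical_points l (Xs n \<omega>))) \<partial>Ms n) \<longlonglongrightarrow>
          (\<integral>\<omega>. h (set_element (critical_points l (X \<omega>))) \<partial>M)"
        by (simp add: H_def)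
    qed
  }
qed

end
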